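(* Let $k\ge 2$ and let $\chi:\{0,1\}^k\to\{0,1\}$ be a predicate which is antisymmetric and satisfies Hypothesis H. Let $F(n,\alpha)$ be the random planted formula of Goldreich type with predicate $\chi$. Then there exist a countable set $\mathcal D$ and a function $\phi_s:[0,\infty)\to[0,1]$ such that for every $\alpha\in[0,\infty)\setminus\mathcal D$ and every $\epsilon>0$, $$\lim_{n\to\infty} Q_n(\alpha,\phi_s(\alpha)-\epsilon)=0 \qquad\text{and}\qquad \lim_{n\to\infty} Q_n(\alpha,\phi_s(\alpha)+\epsilon)=1 .$$
   Context: Antisymmetric: a predicate $\chi:\{0,1\}^k\to\{0,1\}$ is called antisymmetric if $\chi(x)=1-\chi(\overline{x})$ for some $x\in\{0,1\}^k$, where $\overline{x}$ is obtained by flipping every component of $x$. Hypothesis H: for an integer $\ell\ge 1$ let $M_1(\{0,1\}^\ell)$ be the space of probability measures on $\{0,1\}^\ell$ and define $\Gamma_\ell:M_1(\{0,1\}^\ell)\to\mathbb R$ by $$\Gamma_\ell(\nu)=\frac12\sum_{\substack{u^{(1)},\dots,u^{(\ell)}\in\{0,1\}^k\\ \chi(u^{(1)})=\dots=\chi(u^{(\ell)})}}\ \prod_{i=1}^k \nu\bigl(u^{(1)}_i,\dots,u^{(\ell)}_i\bigr).$$ $\chi$ satisfies Hypothesis H if for each $\ell\ge 1$ the map $\Gamma_\ell$ is convex in $\nu$. Random planted formula of Goldreich type: let $V=\{v_1,\dots,v_n\}$ be Boolean variables. Edges are ordered $k$-tuples of distinct elements of $V$; there are $N=\binom nk k!$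 of them. For $y\in\{0,1\}^n$ and an edge $e$, $y[e]\in\{0,1\}^k$ is the restriction of $y$ to $e$, in the order of $e$. Sample $v^0\in\{0,1\}^n$ uniformly at random; then, for each edge $e$ independently with probability $p=\alpha n/N$ (at most $1$ for all large $n$), include in $F(n,\alpha)$ the clause on $e$ requiring $\chi(y[e])=\chi(v^0[e])$. $Z(F(n,\alpha))$ is the number of $y\in\{0,1\}^n$ satisfying all included clauses. For real $\phi$, $Q_n(\alpha,\phi):=\mathbb P[Z(F(n,\alpha))<2^{n\phi}]$. *)

theory Defs
  imports "HOL-Probability.Probability" "HOL-Analysis.Finite_Function_Topology"
begin

text \<open>Bits are booleans, with \<^term>\<open>True\<close> for 1.  A vector of \<open>m\<close> bits is a list of length \<open>m\<close>;
  a predicate on \<open>k\<close> bits is a function on lists, of which only the values on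
  \<open>cube k\<close> are ever used.\<close>

definition cube :: "nat \<Rightarrow> bool list set" where
  "cube m = {x. length x = m}"

definition antisymmetric :: "nat \<Rightarrow> (bool list \<Rightarrow> bool) \<Rightarrow> bool" where
  "antisymmetric k \<psi> \<longleftrightarrow> (\<exists>x \<in> cube k. \<psi> x = (\<not> \<psi> (map Not x)))"

text \<open>A probability measure on \<open>cube l\<close> is given by its point masses.  Finitely supported
  functions are used because they form a real vector space, so that the library notion of
  convexity applies.\<close>

definition prob_measures :: "nat \<Rightarrow> (bool list \<Rightarrow>\<^sub>0 real) set" where
  "prob_measures l = {\<nu>. Poly_Mapping.keys \<nu> \<subseteq> cube l \<and>
     (\<forall>x \<in> cube l. 0 \<le> Poly_Mapping.lookup \<nu> x) \<and>
     (\<Sum>x \<in> cube l. Poly_Mapping.lookup \<nu> x) = 1}"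

text \<open>In the sum, \<open>U\<close> is the list of the vectors \<open>u\<^sup>1\<close>, \<dots>, \<open>u\<^sup>l\<close>.\<close>

definition Gamma_fun :: "nat \<Rightarrow> (bool list \<Rightarrow> bool) \<Rightarrow> nat \<Rightarrow> (bool list \<Rightarrow>\<^sub>0 real) \<Rightarrow> real" where
  "Gamma_fun k \<psi> l \<nu> = 1 / 2 *
     (\<Sum>U \<in> {U. length U = l \<and> set U \<subseteq> cube k \<and> (\<forall>u \<in> set U. \<forall>u' \<in> set U. \<psi> u = \<psi> u')}.
        \<Prod>i<k. Poly_Mapping.lookup \<nu> (map (\<lambda>u. u ! i) U))"

definition hypothesis_H :: "nat \<Rightarrow> (bool list \<Rightarrow> bool) \<Rightarrow> bool" where
  "hypothesis_H k \<psi> \<longleftrightarrow> (\<forall>l\<ge>1. convex_on (prob_measures l) (Gamma_fun k \<psi> l))"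

text \<open>The variables are the indices \<open>0, \<dots>, n - 1\<close>, and an assignment is an element of \<open>cube n\<close>.\<close>

definition edges :: "nat \<Rightarrow> nat \<Rightarrow> nat list set" where
  "edges k n = {e. length e = k \<and> distinct e \<and> set e \<subseteq> {..<n}}"

definition restrict_to :: "bool list \<Rightarrow> nat list \<Rightarrow> bool list" where
  "restrict_to y e = map (\<lambda>i. y ! i) e"

text \<open>For small \<open>n\<close> the quotient below may exceed 1; \<^const>\<open>bernoulli_pmf\<close> then uses the value 1.\<close>

definition edge_prob :: "nat \<Rightarrow> nat \<Rightarrow> real \<Rightarrow> real" where
  "edge_prob k n \<alpha> = \<alpha> * real n / real ((n choose k) * fact k)"

text \<open>A formula is a set of clauses; the clause \<open>(e, b)\<close> requires \<open>\<psi> (y[e]) = b\<close>.\<close>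

definition planted_formula ::
    "nat \<Rightarrow> (bool list \<Rightarrow> bool) \<Rightarrow> nat \<Rightarrow> real \<Rightarrow> (nat list \<times> bool) set pmf" where
  "planted_formula k \<psi> n \<alpha> =
     bind_pmf (pmf_of_set (cube n)) (\<lambda>v0.
       map_pmf (\<lambda>G. (\<lambda>e. (e, \<psi> (restrict_to v0 e))) ` {e \<in> edges k n. G e})
         (Pi_pmf (edges k n) False (\<lambda>_. bernoulli_pmf (edge_prob k n \<alpha>))))"

definition num_solutions :: "(bool list \<Rightarrow> bool) \<Rightarrow> nat \<Rightarrow> (nat list \<times> bool) set \<Rightarrow> nat" where
  "num_solutions \<psi> n F = card {y \<in> cube n. \<forall>(e, b) \<in> F. \<psi> (restrict_to y e) = b}"

definition Q :: "nat \<Rightarrow> (bool list \<Rightarrow> bool) \<Rightarrow> nat \<Rightarrow> real \<Rightarrow> real \<Rightarrow> real" where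
  "Q k \<psi> n \<alpha> \<phi> = measure_pmf.prob (planted_formula k \<psi> n \<alpha>)
     {F. real (num_solutions \<psi> n F) < 2 powr (real n * \<phi>)}"

lemma finite_cube: "finite (cube m)"
  using finite_lists_length_eq[of "UNIV :: bool set" m] by (simp add: cube_def)

lemma card_edges: "card (edges k n) = (n choose k) * fact k"
proof (cases "k \<le> n")
  case True
  have "card (edges k n) = \<Prod>{n - k + 1..n}"
    using card_lists_distinct_length_eq[of "{..<n}" k] True by (simp add: edges_def)
  also have "\<dots> = (n choose k) * fact k"
    using fact_div_fact[of "n - k" n] True
    by (simp add: binomial_fact_lemma [symmetric] mult_ac)
  finally show ?thesis .
next
  case False
  have "edges k n = {}"
  proof (rule ccontr)
    assume "edges k n \<noteq> {}"
    then obtain e where "length e = k" "distinct e" "set e \<subseteq> {..<n}"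
      by (auto simp: edges_def)
    then show False
      using card_mono[of "{..<n}" "set e"] distinct_card[of e] False by simp
  qed
  then show ?thesis using False by simp
qed

lemma lookup_scaleR: "Poly_Mapping.lookup (c *\<^sub>R \<nu>) x = c * Poly_Mapping.lookup \<nu> x"
  by (simp add: scaleR_poly_mapping_def Abs_poly_mapping_inverse)

lemma convex_prob_measures: "convex (prob_measures l)"
proof (rule convexI)
  fix \<mu> \<nu> :: "bool list \<Rightarrow>\<^sub>0 real" and u v :: real
  assume "\<mu> \<in> prob_measures l" "\<nu> \<in> prob_measures l" "0 \<le> u" "0 \<le> v" "u + v = 1"
  then show "u *\<^sub>R \<mu> + v *\<^sub>R \<nu> \<in> prob_measures l"
    by (auto simp: prob_measures_def lookup_add lookup_scaleR sum.distrib in_keys_iff subset_iff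
        simp flip: sum_distrib_left) (metis add_0 mult_zero_right)
qed

end

theory Submission
  imports Defs
begin

text \<open>
  Given the set \<open>S\<close> of the included edges, the planted assignment \<open>v\<close> is uniform on the cube, and the
  solutions of the formula are the assignments that \<open>S\<close> labels like \<open>v\<close>: they form the class of \<open>v\<close>
  for an equivalence relation on the cube.  So, conditionally on the formula, \<open>v\<close> is uniform on the
  set of solutions, and the mean over \<open>v\<close> of the logarithm of the number of solutions
  (\<open>entropy \<psi> n S\<close>, in nats) is the conditional entropy of the planted assignment.  Every argument
  below rests on this: a mean over \<open>v\<close> may be taken class by class (\<open>avg_agree_mean\<close>), and within a
  class the label of a further edge is a random bit that takes each value with the proportion of
  the class on which it occurs.

  The limit of the entropy per variable comes from interpolation. Inserting an edge lowers the
  entropy by the average over \<open>v\<close> of the binary entropy of its label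
  (\<open>entropy_drop\<close>). The power series of \<open>1 - bin_entropy p\<close> in \<open>p ^
  l + (1 - p) ^ l\<close>, \<open>l \<ge> 2\<close>, has positive coefficients. Let \<open>p\<close>
  be the proportion of the solutions that give an edge the label \<open>True\<close>; averaging
  \<open>p ^ l + (1 - p) ^ l\<close> over all \<open>k\<close>-tuples of a variable set
  \<open>J\<close> gives the mean of twice the map of Hypothesis H at the empirical law, on
  \<open>J\<close>, of \<open>l\<close> independent uniform solutions. When \<open>J\<close> is a
  disjoint union, this law is the corresponding mixture, so convexity makes an edge drawn from the
  whole of \<open>J\<close> at least as informative as an edge drawn inside a part chosen with
  probability proportional to its size (\<open>mean_clause_entropy_concave\<close>). Moving the
  clauses continuously from the parts to the whole makes the mean entropy subadditive in the number
  of variables (\<open>poisson_entropy_subadditive\<close>). This is done with tuples that may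
  repeat variables and with inclusion probabilities \<open>1 - exp (- rate)\<close>, since then the
  derivative in the rate of an edge is exactly the effect of inserting it. The entropy is
  1-Lipschitz in the set of edges, so passing to the edge model of the statement costs
  \<open>o(n)\<close> (\<open>poisson_planted_entropy_diff\<close>).

  Concentration comes from a variance bound that is linear in \<open>n\<close> (\<open>planted_variance_le\<close>).  The logarithm of the
  number of solutions is not a Lipschitz function of the planted assignment, since one relabelled
  clause can eliminate almost all solutions; but the loss caused by some clauses has a bounded
  second moment, because a label of small probability \<open>x\<close> is also seen only with probability \<open>x\<close>,
  and \<open>x * (ln x)\<^sup>2\<close> is bounded (\<open>log_ratio_second_moment\<close>).  The Efron--Stein inequality, applied to the bits of
  the planted assignment and then to the edges, sums these bounds.  Chebyshev's inequality
  finishes the proof, at every density \<open>\<alpha>\<close>.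
\<close>

section \<open>Random subsets with independent elements\<close>

text \<open>
  The mean of \<open>f S\<close> when \<open>S\<close> contains each \<open>a \<in> A\<close> independently with probability \<open>p a\<close>.  A finite sum
  is used because its recursion over \<open>A\<close> (\<open>bmean_insert\<close>) turns statements about product measures into
  inductions, and because it is visibly differentiable in the probabilities.
\<close>

definition bmean :: "'a set \<Rightarrow> ('a \<Rightarrow> real) \<Rightarrow> ('a set \<Rightarrow> real) \<Rightarrow> real" where
  "bmean A p f = (\<Sum>S\<in>Pow A. (\<Prod>a\<in>S. p a) * (\<Prod>a\<in>A - S. 1 - p a) * f S)"

lemma bmean_empty [simp]: "bmean {} p f = f {}"
  by (simp add: bmean_def)

lemma bmean_insert:
  assumes "finite A" "a \<notin> A"
  shows "bmean (insert a A) p f = p a * bmean A p (\<lambda>S. f (insert a S)) + (1 - p a) * bmean A p f"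
proof -
  let ?w = "\<lambda>B S. (\<Prod>a\<in>S. p a) * (\<Prod>a\<in>B - S. 1 - p a)"
  \<comment> \<open>The subsets of \<open>insert a A\<close> are split by whether they contain \<open>a\<close>.\<close>
  have disj: "Pow A \<inter> insert a ` Pow A = {}" and inj: "inj_on (insert a) (Pow A)"
    using assms(2) by (auto simp: inj_on_def)
  have w0: "?w (insert a A) S = (1 - p a) * ?w A S" if "S \<in> Pow A" for S
  proof -
    have "insert a A - S = insert a (A - S)" "a \<notin> A - S"
      using that assms(2) by auto
    then show ?thesis using assms(1) by simp
  qed
  have w1: "?w (insert a A) (insert a S) = p a * ?w A S" if "S \<in> Pow A" for S
  proof -
    have "insert a A - insert a S = A - S" "a \<notin> S" "finite S"
      using that assms by (auto intro: finite_subset)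
    then show ?thesis by simp
  qed
  have "bmean (insert a A) p f = (\<Sum>S\<in>Pow A. ?w (insert a A) S * f S)
      + (\<Sum>S\<in>Pow A. ?w (insert a A) (insert a S) * f (insert a S))"
    unfolding bmean_def Pow_insert using assms(1) disj inj
    by (subst sum.union_disjoint) (auto simp: sum.reindex)
  also have "(\<Sum>S\<in>Pow A. ?w (insert a A) S * f S) = (1 - p a) * bmean A p f"
    unfolding bmean_def sum_distrib_left by (intro sum.cong refl) (subst w0; simp)
  also have "(\<Sum>S\<in>Pow A. ?w (insert a A) (insert a S) * f (insert a S))
      = p a * bmean A p (\<lambda>S. f (insert a S))"
    unfolding bmean_def sum_distrib_left by (intro sum.cong refl) (subst w1; simp)
  finally show ?thesis by simp
qed

lemma bmean_cong:
  assumes "\<And>S. S \<subseteq> A \<Longrightarrow> f S = g S" "\<And>a. a \<in> A \<Longrightarrow> p a = q a"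
  shows "bmean A p f = bmean A q g"
  unfolding bmean_def using assms
  by (intro sum.cong refl arg_cong2[where f = "(*)"] prod.cong) auto

lemma bmean_add: "bmean A p (\<lambda>S. f S + g S) = bmean A p f + bmean A p g"
  by (simp add: bmean_def algebra_simps sum.distrib)

lemma bmean_diff: "bmean A p (\<lambda>S. f S - g S) = bmean A p f - bmean A p g"
  by (simp add: bmean_def algebra_simps sum_subtractf)

lemma bmean_cmult: "bmean A p (\<lambda>S. c * f S) = c * bmean A p f"
  by (simp add: bmean_def sum_distrib_left mult_ac)

lemma bmean_sum: "bmean A p (\<lambda>S. \<Sum>i\<in>I. f i S) = (\<Sum>i\<in>I. bmean A p (f i))"
  unfolding bmean_def by (subst sum.swap) (simp add: sum_distrib_left)

lemma bmean_const: "finite A \<Longrightarrow> bmean A p (\<lambda>_. c) = c"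
  by (induction A rule: finite_induct) (auto simp: bmean_insert algebra_simps)

lemma bmean_mono:
  assumes "\<And>a. a \<in> A \<Longrightarrow> 0 \<le> p a \<and> p a \<le> 1" "\<And>S. S \<subseteq> A \<Longrightarrow> f S \<le> g S"
  shows "bmean A p f \<le> bmean A p g"
  unfolding bmean_def using assms
  by (intro sum_mono mult_left_mono mult_nonneg_nonneg prod_nonneg) auto

lemma bmean_Un:
  assumes "finite A" "finite B" "A \<inter> B = {}"
  shows "bmean (A \<union> B) p f = bmean A p (\<lambda>S. bmean B p (\<lambda>T. f (S \<union> T)))"
  using assms
proof (induction A arbitrary: f rule: finite_induct)
  case (insert a A)
  then show ?case by (simp add: bmean_insert)
qed simp

lemma bmean_image:
  assumes "finite A" "inj_on g A"
  shows "bmean (g ` A) p f = bmean A (\<lambda>a. p (g a)) (\<lambda>S. f (g ` S))"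
  using assms
proof (induction A arbitrary: f rule: finite_induct)
  case (insert a A)
  then have "g a \<notin> g ` A" by auto
  with insert show ?case by (simp add: bmean_insert)
qed simp

lemma bmean_zero:
  assumes "finite A" "\<And>a. a \<in> A \<Longrightarrow> p a = 0"
  shows "bmean A p f = f {}"
  using assms by (induction A arbitrary: f rule: finite_induct) (auto simp: bmean_insert)

lemma bmean_restrict:
  assumes "finite A" "B \<subseteq> A" "\<And>a. a \<in> A - B \<Longrightarrow> p a = 0"
  shows "bmean A p f = bmean B p f"
proof -
  have "A = B \<union> (A - B)" using assms by auto
  then have "bmean A p f = bmean B p (\<lambda>S. bmean (A - B) p (\<lambda>T. f (S \<union> T)))"
    using bmean_Un[of B "A - B" p f] assms by (auto intro: finite_subset)
  also have "\<dots> = bmean B p f"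
    using assms by (intro bmean_cong refl) (subst bmean_zero; auto)
  finally show ?thesis .
qed

text \<open>
  Coupling the two random sets element by element, they differ at \<open>a\<close> with probability
  \<open>\<bar>p a - q a\<bar>\<close>.
\<close>

lemma bmean_lipschitz:
  assumes "finite A"
    and "\<And>a. a \<in> A \<Longrightarrow> 0 \<le> p a \<and> p a \<le> 1" "\<And>a. a \<in> A \<Longrightarrow> 0 \<le> q a \<and> q a \<le> 1"
    and "\<And>S a. S \<subseteq> A \<Longrightarrow> a \<in> A \<Longrightarrow> \<bar>f (insert a S) - f S\<bar> \<le> 1"
  shows "\<bar>bmean A p f - bmean A q f\<bar> \<le> (\<Sum>a\<in>A. \<bar>p a - q a\<bar>)"
  using assms
proof (induction A arbitrary: f rule: finite_induct)
  case (insert a A)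
  let ?f = "\<lambda>S. f (insert a S)"
  have p: "0 \<le> p b \<and> p b \<le> 1" and q: "0 \<le> q b \<and> q b \<le> 1" if "b \<in> A" for b
    using insert.prems that by auto
  have qa: "0 \<le> q a" "q a \<le> 1" using insert.prems by auto
  have 1: "\<bar>bmean A p ?f - bmean A q ?f\<bar> \<le> (\<Sum>a\<in>A. \<bar>p a - q a\<bar>)"
  proof (intro insert.IH p q)
    fix S b assume "S \<subseteq> A" "b \<in> A"
    then show "\<bar>f (insert a (insert b S)) - f (insert a S)\<bar> \<le> 1"
      using insert.prems(3)[of "insert a S" b] by (auto simp: insert_commute)
  qed
  have 0: "\<bar>bmean A p f - bmean A q f\<bar> \<le> (\<Sum>a\<in>A. \<bar>p a - q a\<bar>)"
    by (intro insert.IH p q insert.prems(3)) auto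
  have inc: "- 1 \<le> ?f S - f S \<and> ?f S - f S \<le> 1" if "S \<subseteq> A" for S
    using insert.prems(3)[OF subset_insertI2[OF that] insertI1] by linarith
  have "bmean A p (\<lambda>S. ?f S - f S) \<le> bmean A p (\<lambda>_. 1)"
    using inc p by (intro bmean_mono) auto
  moreover have "bmean A p (\<lambda>_. -1) \<le> bmean A p (\<lambda>S. ?f S - f S)"
    using inc p by (intro bmean_mono) auto
  ultimately have 2: "\<bar>bmean A p ?f - bmean A p f\<bar> \<le> 1"
    using insert.hyps by (simp add: bmean_const bmean_diff)
  have "bmean (insert a A) p f - bmean (insert a A) q f
      = (p a - q a) * (bmean A p ?f - bmean A p f)
      + (q a * (bmean A p ?f - bmean A q ?f) + (1 - q a) * (bmean A p f - bmean A q f))"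
    using insert.hyps by (simp add: bmean_insert algebra_simps)
  also have "\<bar>\<dots>\<bar> \<le> \<bar>p a - q a\<bar> * 1
      + (q a * (\<Sum>a\<in>A. \<bar>p a - q a\<bar>) + (1 - q a) * (\<Sum>a\<in>A. \<bar>p a - q a\<bar>))"
    using qa 0 1 2
    by (intro order_trans[OF abs_triangle_ineq] add_mono)
       (auto simp: abs_mult intro!: mult_left_mono mult_left_le)
  also have "\<dots> = (\<Sum>a\<in>insert a A. \<bar>p a - q a\<bar>)"
    using insert.hyps by (simp add: algebra_simps)
  finally show ?case .
qed simp

text \<open>
  With probability \<open>1 - exp (- rate)\<close>, the derivative in the rate at \<open>a\<close> is \<open>exp (- rate)\<close> times the
  difference between having and not having \<open>a\<close>.  The factor is the probability that \<open>a\<close> is absent,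
  so the result is the mean effect of inserting \<open>a\<close> into the random set itself, without
  conditioning.
\<close>

lemma bmean_has_derivative:
  assumes "finite A"
  shows "((\<lambda>t. bmean A (\<lambda>a. 1 - exp (- (b a + t * c a))) f) has_real_derivative
      (\<Sum>a\<in>A. c a * bmean A (\<lambda>a. 1 - exp (- (b a + t * c a))) (\<lambda>S. f (insert a S) - f S))) (at t)"
  using assms
proof (induction A arbitrary: f rule: finite_induct)
  case (insert a A)
  let ?p = "\<lambda>t a. 1 - exp (- (b a + t * c a))"
  let ?E = "\<lambda>f. bmean A (?p t) f" and ?f = "\<lambda>S. f (insert a S)"
  let ?D = "\<lambda>f. \<Sum>e\<in>A. c e * bmean A (?p t) (\<lambda>S. f (insert e S) - f S)"
  have "((\<lambda>t. ?p t a * bmean A (?p t) ?f + (1 - ?p t a) * bmean A (?p t) f) has_real_derivative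
      (c a * (1 - ?p t a)) * ?E ?f + ?p t a * ?D ?f
      + (- (c a * (1 - ?p t a)) * ?E f + (1 - ?p t a) * ?D f)) (at t)"
    by (rule insert.IH derivative_eq_intros refl | simp)+
  moreover have "(c a * (1 - ?p t a)) * ?E ?f + ?p t a * ?D ?f
      + (- (c a * (1 - ?p t a)) * ?E f + (1 - ?p t a) * ?D f)
      = (\<Sum>e\<in>insert a A. c e * bmean (insert a A) (?p t) (\<lambda>S. f (insert e S) - f S))"
  proof -
    have "(\<Sum>e\<in>A. c e * bmean (insert a A) (?p t) (\<lambda>S. f (insert e S) - f S))
        = ?p t a * ?D ?f + (1 - ?p t a) * ?D f"
      using insert.hyps
      by (simp add: bmean_insert sum_distrib_left sum.distrib[symmetric] insert_commute algebra_simps)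
    moreover have "c a * bmean (insert a A) (?p t) (\<lambda>S. f (insert a S) - f S)
        = c a * ((1 - ?p t a) * (?E ?f - ?E f))"
      unfolding bmean_insert[OF insert.hyps] insert_absorb2 diff_self bmean_diff
        bmean_const[OF insert.hyps(1)] by (simp add: right_diff_distrib)
    ultimately show ?thesis
      using insert.hyps by (simp add: algebra_simps)
  qed
  ultimately show ?case
    unfolding bmean_insert[OF insert.hyps, of _ f] by simp
qed simp

lemma one_minus_exp_bounds:
  fixes x :: real
  shows "0 \<le> x \<Longrightarrow> 0 \<le> 1 - exp (- x) \<and> 1 - exp (- x) \<le> 1"
  by simp

text \<open>
  The interpolation principle: the rates are moved from \<open>x\<close> to \<open>y\<close> on a straight line, and the
  hypothesis bounds the derivative pointwise in \<open>S\<close>.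
\<close>

lemma bmean_rate_mono:
  assumes "finite A" and "\<And>a. a \<in> A \<Longrightarrow> 0 \<le> x a" "\<And>a. a \<in> A \<Longrightarrow> 0 \<le> y a"
    and "\<And>S. S \<subseteq> A \<Longrightarrow> (\<Sum>a\<in>A. (y a - x a) * (f (insert a S) - f S)) \<le> 0"
  shows "bmean A (\<lambda>a. 1 - exp (- y a)) f \<le> bmean A (\<lambda>a. 1 - exp (- x a)) f"
proof -
  let ?p = "\<lambda>t a. 1 - exp (- (x a + t * (y a - x a)))"
  let ?g = "\<lambda>t. bmean A (?p t) f"
  have "?g 1 \<le> ?g 0"
  proof (rule DERIV_nonpos_imp_nonincreasing[of 0 1 ?g])
    fix t :: real assume t: "0 \<le> t" "t \<le> 1"
    have rate: "0 \<le> x a + t * (y a - x a)" if "a \<in> A" for a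
    proof -
      have "x a + t * (y a - x a) = (1 - t) * x a + t * y a" by (simp add: algebra_simps)
      then show ?thesis using assms(2,3)[OF that] t by simp
    qed
    have "(\<Sum>a\<in>A. (y a - x a) * bmean A (?p t) (\<lambda>S. f (insert a S) - f S))
        = bmean A (?p t) (\<lambda>S. \<Sum>a\<in>A. (y a - x a) * (f (insert a S) - f S))"
      by (simp add: bmean_sum bmean_cmult)
    also have "\<dots> \<le> bmean A (?p t) (\<lambda>_. 0)"
      using rate assms(4) by (intro bmean_mono one_minus_exp_bounds)
    also have "\<dots> = 0" using assms(1) by (simp add: bmean_const)
    finally show "\<exists>d. (?g has_real_derivative d) (at t) \<and> d \<le> 0"
      using bmean_has_derivative[OF assms(1), of x "\<lambda>a. y a - x a" f t] by blast
  qed simp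
  then show ?thesis by simp
qed

lemma power2_bmean_le:
  assumes "finite A" "\<And>a. a \<in> A \<Longrightarrow> 0 \<le> p a \<and> p a \<le> 1"
  shows "(bmean A p f)\<^sup>2 \<le> bmean A p (\<lambda>S. (f S)\<^sup>2)"
proof -
  let ?m = "bmean A p f"
  have "0 = bmean A p (\<lambda>_. 0)" using assms by (simp add: bmean_const)
  also have "\<dots> \<le> bmean A p (\<lambda>S. (f S - ?m)\<^sup>2)" using assms by (intro bmean_mono) auto
  also have "\<dots> = bmean A p (\<lambda>S. (f S)\<^sup>2) + (?m\<^sup>2 - 2 * ?m * ?m)"
  proof -
    have "(\<lambda>S. (f S - ?m)\<^sup>2) = (\<lambda>S. (f S)\<^sup>2 + (?m\<^sup>2 - 2 * ?m * f S))"
      by (simp add: power2_diff fun_eq_iff)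
    then show ?thesis
      using assms(1) by (simp only: bmean_add bmean_diff bmean_cmult bmean_const)
  qed
  finally show ?thesis by (simp add: power2_eq_square)
qed

text \<open>
  The Efron--Stein inequality.  The comparison function \<open>g a\<close> may be anything that ignores whether
  \<open>a\<close> is present.  In the induction, the variance splits into the mean of the
  conditional variances given the new element, bounded by the induction hypothesis, and the
  variance of the conditional mean, which is at most the mean square of its distance to the
  constant \<open>bmean A p (g a)\<close>.
\<close>

lemma efron_stein:
  assumes "finite A" "\<And>a. a \<in> A \<Longrightarrow> 0 \<le> p a \<and> p a \<le> 1"
    and "\<And>a S. a \<in> A \<Longrightarrow> S \<subseteq> A \<Longrightarrow> g a (insert a S) = g a (S - {a})"
  shows "bmean A p (\<lambda>S. (f S - bmean A p f)\<^sup>2) \<le> (\<Sum>a\<in>A. bmean A p (\<lambda>S. (f S - g a S)\<^sup>2))"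
  using assms
proof (induction A arbitrary: f g rule: finite_induct)
  case (insert a A)
  let ?E = "bmean A p" and ?E' = "bmean (insert a A) p"
  let ?f = "\<lambda>S. f (insert a S)"
  have p: "0 \<le> p b \<and> p b \<le> 1" if "b \<in> A" for b using insert.prems that by auto
  have pa: "0 \<le> p a" "0 \<le> 1 - p a" using insert.prems by auto
  \<comment> \<open>The cross term vanishes, being a multiple of the mean of \<open>h S - ?E h\<close>.\<close>
  have split: "?E (\<lambda>S. (h S - c)\<^sup>2) = ?E (\<lambda>S. (h S - ?E h)\<^sup>2) + (?E h - c)\<^sup>2" for h and c :: real
  proof -
    have "(\<lambda>S. (h S - c)\<^sup>2)
        = (\<lambda>S. (h S - ?E h)\<^sup>2 + (2 * (?E h - c) * (h S - ?E h) + (?E h - c)\<^sup>2))"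
      by (simp add: fun_eq_iff power2_eq_square algebra_simps)
    then have "?E (\<lambda>S. (h S - c)\<^sup>2)
        = ?E (\<lambda>S. (h S - ?E h)\<^sup>2) + (2 * (?E h - c) * (?E h - ?E h) + (?E h - c)\<^sup>2)"
      using insert.hyps by (simp only: bmean_add bmean_diff bmean_cmult bmean_const)
    then show ?thesis by simp
  qed
  let ?m = "?E' f" and ?c = "?E (g a)"
  have m: "?m = p a * ?E ?f + (1 - p a) * ?E f" using insert.hyps by (rule bmean_insert)
  have ga: "g a (insert a S) = g a S" if "S \<subseteq> A" for S
  proof -
    have "S - {a} = S" using that insert.hyps by auto
    then show ?thesis using insert.prems(2)[of a S] that by auto
  qed
  have IH1: "?E (\<lambda>S. (?f S - ?E ?f)\<^sup>2) \<le> (\<Sum>b\<in>A. ?E (\<lambda>S. (?f S - g b (insert a S))\<^sup>2))"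
  proof (intro insert.IH p)
    fix b S assume "b \<in> A" "S \<subseteq> A"
    moreover from this have "insert a S - {b} = insert a (S - {b})" using insert.hyps by auto
    ultimately show "g b (insert a (insert b S)) = g b (insert a (S - {b}))"
      using insert.prems(2)[of b "insert a S"] by (auto simp: insert_commute)
  qed
  have IH0: "?E (\<lambda>S. (f S - ?E f)\<^sup>2) \<le> (\<Sum>b\<in>A. ?E (\<lambda>S. (f S - g b S)\<^sup>2))"
    using insert.prems(2) by (intro insert.IH p) auto
  have "?E' (\<lambda>S. (f S - ?m)\<^sup>2)
      = p a * ?E (\<lambda>S. (?f S - ?m)\<^sup>2) + (1 - p a) * ?E (\<lambda>S. (f S - ?m)\<^sup>2)"
    using insert.hyps by (rule bmean_insert)
  also have "\<dots> = p a * ?E (\<lambda>S. (?f S - ?E ?f)\<^sup>2) + (1 - p a) * ?E (\<lambda>S. (f S - ?E f)\<^sup>2)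
      + (p a * (?E ?f - ?m)\<^sup>2 + (1 - p a) * (?E f - ?m)\<^sup>2)"
    by (simp add: split[of ?f ?m] split[of f ?m] algebra_simps)
  \<comment> \<open>The mean \<open>?m\<close> minimises the mean square distance, here with the exact deficit \<open>(?m - ?c)\<^sup>2\<close>.\<close>
  also have "p a * (?E ?f - ?m)\<^sup>2 + (1 - p a) * (?E f - ?m)\<^sup>2
      = p a * (?E ?f - ?c)\<^sup>2 + (1 - p a) * (?E f - ?c)\<^sup>2 - (?m - ?c)\<^sup>2"
    by (simp add: m power2_eq_square algebra_simps)
  also have "p a * ?E (\<lambda>S. (?f S - ?E ?f)\<^sup>2) + (1 - p a) * ?E (\<lambda>S. (f S - ?E f)\<^sup>2)
      + (p a * (?E ?f - ?c)\<^sup>2 + (1 - p a) * (?E f - ?c)\<^sup>2 - (?m - ?c)\<^sup>2)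
      \<le> p a * (\<Sum>b\<in>A. ?E (\<lambda>S. (?f S - g b (insert a S))\<^sup>2))
        + (1 - p a) * (\<Sum>b\<in>A. ?E (\<lambda>S. (f S - g b S)\<^sup>2))
        + (p a * ?E (\<lambda>S. (?f S - g a S)\<^sup>2) + (1 - p a) * ?E (\<lambda>S. (f S - g a S)\<^sup>2) - 0)"
  proof (intro add_mono diff_mono mult_left_mono IH1 IH0 pa)
    show "(?E ?f - ?c)\<^sup>2 \<le> ?E (\<lambda>S. (?f S - g a S)\<^sup>2)"
      using power2_bmean_le[of A p "\<lambda>S. ?f S - g a S"] insert.hyps p by (simp add: bmean_diff)
    show "(?E f - ?c)\<^sup>2 \<le> ?E (\<lambda>S. (f S - g a S)\<^sup>2)"
      using power2_bmean_le[of A p "\<lambda>S. f S - g a S"] insert.hyps p by (simp add: bmean_diff)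
  qed simp
  also have "?E (\<lambda>S. (?f S - g a S)\<^sup>2) = ?E (\<lambda>S. (?f S - g a (insert a S))\<^sup>2)"
    by (intro bmean_cong) (auto simp: ga)
  also have "p a * (\<Sum>b\<in>A. ?E (\<lambda>S. (?f S - g b (insert a S))\<^sup>2))
        + (1 - p a) * (\<Sum>b\<in>A. ?E (\<lambda>S. (f S - g b S)\<^sup>2))
        + (p a * ?E (\<lambda>S. (?f S - g a (insert a S))\<^sup>2) + (1 - p a) * ?E (\<lambda>S. (f S - g a S)\<^sup>2) - 0)
      = (\<Sum>b\<in>insert a A. ?E' (\<lambda>S. (f S - g b S)\<^sup>2))"
    using insert.hyps by (simp add: bmean_insert sum.distrib sum_distrib_left sum_subtractf algebra_simps)
  finally show ?case .
qed simp

text \<open>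
  Each element of \<open>A \<inter> B\<close> contributes the factor \<open>1 + p a \<le> exp (p a)\<close>.
\<close>

lemma bmean_power_card_le:
  assumes "finite A" "\<And>a. a \<in> A \<Longrightarrow> 0 \<le> p a \<and> p a \<le> 1"
  shows "bmean A p (\<lambda>S. 2 ^ card (S \<inter> B)) \<le> exp (\<Sum>a\<in>A \<inter> B. p a)"
  using assms
proof (induction A rule: finite_induct)
  case (insert a A)
  let ?F = "\<lambda>S. (2::real) ^ card (S \<inter> B)"
  have IH: "bmean A p ?F \<le> exp (\<Sum>a\<in>A \<inter> B. p a)" using insert by auto
  show ?case
  proof (cases "a \<in> B")
    case True
    have "bmean A p (\<lambda>S. ?F (insert a S)) = bmean A p (\<lambda>S. 2 * ?F S)"
    proof (intro bmean_cong refl)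
      fix S assume "S \<subseteq> A"
      then have "a \<notin> S" "finite S" using insert.hyps by (auto intro: finite_subset)
      then show "?F (insert a S) = 2 * ?F S" using True by simp
    qed
    then have "bmean (insert a A) p ?F = (1 + p a) * bmean A p ?F"
      using insert.hyps by (simp add: bmean_insert bmean_cmult algebra_simps)
    also have "\<dots> \<le> exp (p a) * exp (\<Sum>a\<in>A \<inter> B. p a)"
      using IH insert.prems[of a] bmean_mono[of A p "\<lambda>_. 0" ?F] insert.prems insert.hyps
      by (intro mult_mono exp_ge_add_one_self) (auto simp: bmean_const)
    also have "\<dots> = exp (\<Sum>a\<in>insert a A \<inter> B. p a)"
      using insert.hyps True by (simp add: exp_add)
    finally show ?thesis .
  next
    case False
    then show ?thesis using insert.hyps IH by (simp add: bmean_insert algebra_simps)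
  qed
qed simp

section \<open>Assignments with equal labels, and the entropy of the planted assignment\<close>

lemma card_cube: "card (cube n) = 2 ^ n"
  using card_lists_length_eq[of "UNIV :: bool set" n] by (simp add: cube_def)

definition avg :: "nat \<Rightarrow> (bool list \<Rightarrow> real) \<Rightarrow> real" where
  "avg n f = (\<Sum>v\<in>cube n. f v) / 2 ^ n"

lemma avg_const: "avg n (\<lambda>_. c) = c"
  by (simp add: avg_def card_cube)

lemma avg_mono: "(\<And>v. v \<in> cube n \<Longrightarrow> f v \<le> g v) \<Longrightarrow> avg n f \<le> avg n g"
  by (simp add: avg_def divide_right_mono sum_mono)

lemma avg_cong: "(\<And>v. v \<in> cube n \<Longrightarrow> f v = g v) \<Longrightarrow> avg n f = avg n g"
  by (simp add: avg_def)

lemma avg_diff: "avg n (\<lambda>v. f v - g v) = avg n f - avg n g"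
  by (simp add: avg_def sum_subtractf diff_divide_distrib)

lemma avg_add: "avg n (\<lambda>v. f v + g v) = avg n f + avg n g"
  by (simp add: avg_def sum.distrib add_divide_distrib)

lemma avg_cmult: "avg n (\<lambda>v. c * f v) = c * avg n f"
  by (simp add: avg_def sum_distrib_left)

lemma avg_sum: "avg n (\<lambda>v. \<Sum>i\<in>I. f i v) = (\<Sum>i\<in>I. avg n (f i))"
  unfolding avg_def by (subst sum.swap) (simp add: sum_divide_distrib)

text \<open>
  The solutions of the formula with edge set \<open>S\<close> and planted assignment \<open>v\<close>.
\<close>

definition agree :: "(bool list \<Rightarrow> bool) \<Rightarrow> nat \<Rightarrow> nat list set \<Rightarrow> bool list \<Rightarrow> bool list set" where
  "agree \<psi> n S v = {y \<in> cube n. \<forall>e\<in>S. \<psi> (restrict_to y e) = \<psi> (restrict_to v e)}"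

lemma agree_subset: "agree \<psi> n S v \<subseteq> cube n"
  by (auto simp: agree_def)

lemma finite_agree: "finite (agree \<psi> n S v)"
  using agree_subset finite_cube by (rule finite_subset)

lemma agree_self: "v \<in> cube n \<Longrightarrow> v \<in> agree \<psi> n S v"
  by (simp add: agree_def)

lemma agree_eq: "u \<in> agree \<psi> n S v \<Longrightarrow> agree \<psi> n S u = agree \<psi> n S v"
  by (auto simp: agree_def)

lemma card_agree_pos: "v \<in> cube n \<Longrightarrow> 0 < card (agree \<psi> n S v)"
  using agree_self finite_agree card_gt_0_iff by blast

lemma card_agree_le: "card (agree \<psi> n S v) \<le> 2 ^ n"
  using card_mono[OF finite_cube agree_subset] by (simp add: card_cube)

definition entropy :: "(bool list \<Rightarrow> bool) \<Rightarrow> nat \<Rightarrow> nat list set \<Rightarrow> real" where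
  "entropy \<psi> n S = avg n (\<lambda>v. ln (real (card (agree \<psi> n S v))))"

lemma entropy_nonneg: "0 \<le> entropy \<psi> n S"
proof -
  have "avg n (\<lambda>_. 0) \<le> entropy \<psi> n S"
    unfolding entropy_def using card_agree_pos by (intro avg_mono) (force simp: Suc_le_eq)
  then show ?thesis by (simp add: avg_const)
qed

lemma ln_card_agree_le:
  assumes "v \<in> cube n"
  shows "ln (real (card (agree \<psi> n S v))) \<le> real n * ln 2"
proof -
  have "ln (real (card (agree \<psi> n S v))) \<le> ln (real (2 ^ n))"
    using card_agree_pos[OF assms] card_agree_le[of \<psi> n S v]
    by (intro ln_mono) (auto simp only: of_nat_le_iff of_nat_0_less_iff)
  then show ?thesis by (simp add: ln_realpow)
qed

lemma entropy_le: "entropy \<psi> n S \<le> real n * ln 2"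
proof -
  have "entropy \<psi> n S \<le> avg n (\<lambda>_. real n * ln 2)"
    unfolding entropy_def by (intro avg_mono ln_card_agree_le)
  then show ?thesis by (simp add: avg_const)
qed

text \<open>
  Replacing \<open>f\<close> by its means over the classes of a partition does not change the sum:
  \<open>f u\<close> is counted once, with weight \<open>1 / card (C u)\<close>, for every \<open>v\<close> in the class of \<open>u\<close>.
\<close>

lemma sum_class_mean:
  fixes f :: "'a \<Rightarrow> real"
  assumes "finite V" and "\<And>v. v \<in> V \<Longrightarrow> C v \<subseteq> V" "\<And>v. v \<in> V \<Longrightarrow> v \<in> C v"
    and "\<And>u v. v \<in> V \<Longrightarrow> u \<in> C v \<Longrightarrow> C u = C v"
  shows "(\<Sum>v\<in>V. f v) = (\<Sum>v\<in>V. (\<Sum>u\<in>C v. f u) / card (C v))"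
proof -
  have sym: "u \<in> C v \<longleftrightarrow> v \<in> C u" if "u \<in> V" "v \<in> V" for u v
    using assms(3,4) that by blast
  have fin: "finite (C v)" if "v \<in> V" for v
    using assms(1,2) that finite_subset by blast
  have "(\<Sum>v\<in>V. (\<Sum>u\<in>C v. f u) / card (C v))
      = (\<Sum>v\<in>V. \<Sum>u\<in>V. if u \<in> C v then f u / card (C v) else 0)"
  proof (intro sum.cong refl)
    fix v assume "v \<in> V"
    then have "V \<inter> C v = C v" using assms(2) by blast
    then show "(\<Sum>u\<in>C v. f u) / card (C v) = (\<Sum>u\<in>V. if u \<in> C v then f u / card (C v) else 0)"
      using assms(1) by (simp add: sum.If_cases sum_divide_distrib)
  qed
  also have "\<dots> = (\<Sum>u\<in>V. \<Sum>v\<in>V. if u \<in> C v then f u / card (C v) else 0)"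
    by (rule sum.swap)
  also have "\<dots> = (\<Sum>u\<in>V. f u)"
  proof (intro sum.cong refl)
    fix u assume u: "u \<in> V"
    then have sub: "V \<inter> C u = C u" using assms(2) by blast
    have ne: "card (C u) \<noteq> 0" using assms(3)[OF u] fin[OF u] by auto
    have "(\<Sum>v\<in>V. if u \<in> C v then f u / card (C v) else 0)
        = (\<Sum>v\<in>V. if v \<in> C u then f u / card (C u) else 0)"
      using sym[OF u] assms(4)[OF u] by (intro sum.cong refl) auto
    also have "\<dots> = f u"
      using assms(1) sub ne by (simp add: sum.If_cases)
    finally show "(\<Sum>v\<in>V. if u \<in> C v then f u / card (C v) else 0) = f u" .
  qed
  finally show ?thesis by simp
qed

lemma avg_agree_mean:
  "avg n f = avg n (\<lambda>v. (\<Sum>u\<in>agree \<psi> n S v. f u) / card (agree \<psi> n S v))"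
  unfolding avg_def
  by (subst sum_class_mean[of "cube n" "agree \<psi> n S"])
     (auto simp: finite_cube agree_self agree_eq dest: subsetD[OF agree_subset])

definition bin_entropy :: "real \<Rightarrow> real" where
  "bin_entropy p = - (p * ln p) - (1 - p) * ln (1 - p)"

lemma bin_entropy_bounds:
  assumes "0 \<le> p" "p \<le> 1"
  shows "0 \<le> bin_entropy p" "bin_entropy p \<le> 1"
proof -
  have "0 \<le> - (q * ln q) \<and> - (q * ln q) \<le> 1 - q" if "0 \<le> q" "q \<le> 1" for q :: real
  proof (cases "q = 0")
    case False
    with that have q: "0 < q" by simp
    then have "ln (1 / q) \<le> 1 / q - 1" by (intro ln_le_minus_one) simp
    then have "q * - ln q \<le> q * (1 / q - 1)"
      using q by (intro mult_left_mono) (auto simp: ln_div)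
    moreover have "q * ln q \<le> 0" using q that by (simp add: mult_nonneg_nonpos)
    ultimately show ?thesis using q by (simp add: right_diff_distrib)
  qed simp
  from this[of p] this[of "1 - p"] assms show "0 \<le> bin_entropy p" "bin_entropy p \<le> 1"
    by (auto simp: bin_entropy_def)
qed

definition true_frac :: "(bool list \<Rightarrow> bool) \<Rightarrow> nat list \<Rightarrow> bool list set \<Rightarrow> real" where
  "true_frac \<psi> e C = card {y \<in> C. \<psi> (restrict_to y e)} / card C"

lemma true_frac_bounds: "finite C \<Longrightarrow> 0 \<le> true_frac \<psi> e C" "finite C \<Longrightarrow> true_frac \<psi> e C \<le> 1"
  by (auto simp: true_frac_def divide_le_eq card_mono)

lemma true_frac_Not:
  assumes "finite C" "C \<noteq> {}"
  shows "1 - true_frac \<psi> e C = card {y \<in> C. \<not> \<psi> (restrict_to y e)} / card C"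
proof -
  have "card C = card {y \<in> C. \<psi> (restrict_to y e)} + card {y \<in> C. \<not> \<psi> (restrict_to y e)}"
    using assms(1) by (subst card_Un_disjoint[symmetric]) (auto intro: arg_cong[where f = card])
  then have "real (card C) = card {y \<in> C. \<psi> (restrict_to y e)} + card {y \<in> C. \<not> \<psi> (restrict_to y e)}"
    by (simp only: of_nat_add)
  moreover have "real (card C) \<noteq> 0" using assms by simp
  ultimately show ?thesis
    by (simp add: true_frac_def field_simps)
qed

text \<open>
  Inside a class of size \<open>c\<close>, the new edge keeps \<open>d\<close> of the assignments for each of the \<open>d\<close>
  planted assignments with the same label.  So the mean loss is \<open>d / c * ln (c / d)\<close>
  summed over both labels, a binary entropy.
\<close>

lemma entropy_drop:
  "entropy \<psi> n S - entropy \<psi> n (insert e S)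
     = avg n (\<lambda>v. bin_entropy (true_frac \<psi> e (agree \<psi> n S v)))"
proof -
  let ?F = "\<lambda>v. ln (real (card (agree \<psi> n S v))) - ln (real (card (agree \<psi> n (insert e S) v)))"
  have "entropy \<psi> n S - entropy \<psi> n (insert e S) = avg n ?F"
    by (simp add: entropy_def avg_diff)
  also have "\<dots> = avg n (\<lambda>v. (\<Sum>u\<in>agree \<psi> n S v. ?F u) / card (agree \<psi> n S v))"
    by (rule avg_agree_mean)
  also have "\<dots> = avg n (\<lambda>v. bin_entropy (true_frac \<psi> e (agree \<psi> n S v)))"
  proof (rule avg_cong)
    fix v assume v: "v \<in> cube n"
    let ?C = "agree \<psi> n S v"
    let ?D = "\<lambda>b. {y \<in> ?C. \<psi> (restrict_to y e) = b}"
    let ?c = "real (card ?C)" and ?d = "\<lambda>b. real (card (?D b))"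
    have C: "0 < ?c" using v by (simp add: card_agree_pos)
    have F: "?F u = ln ?c - ln (?d (\<psi> (restrict_to u e)))" if "u \<in> ?C" for u
    proof -
      have "agree \<psi> n (insert e S) u = ?D (\<psi> (restrict_to u e))"
        using that by (auto simp: agree_def)
      then show ?thesis using agree_eq[OF that] by simp
    qed
    have "(\<Sum>u\<in>?C. ?F u) = (\<Sum>u\<in>?D True. ?F u) + (\<Sum>u\<in>?D False. ?F u)"
      using finite_agree[of \<psi> n S v]
      by (subst sum.union_disjoint[symmetric]) (auto intro!: sum.cong)
    also have "\<dots> = (\<Sum>u\<in>?D True. ln ?c - ln (?d True)) + (\<Sum>u\<in>?D False. ln ?c - ln (?d False))"
      by (intro arg_cong2[where f = "(+)"] sum.cong refl) (use F in auto)
    also have "\<dots> = ?d True * (ln ?c - ln (?d True)) + ?d False * (ln ?c - ln (?d False))"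
      by simp
    finally have "(\<Sum>u\<in>?C. ?F u) / ?c
        = (?d True * (ln ?c - ln (?d True)) + ?d False * (ln ?c - ln (?d False))) / ?c"
      by (rule arg_cong[where f = "\<lambda>s. s / ?c"])
    also have "\<dots> = - (?d True / ?c * ln (?d True / ?c)) - (?d False / ?c * ln (?d False / ?c))"
    proof -
      have *: "d * (ln c - ln d) / c = - (d / c * ln (d / c))" if "0 \<le> d" "0 < c" for c d :: real
        using that by (cases "d = 0") (auto simp: ln_div right_diff_distrib diff_divide_distrib)
      show ?thesis
        by (simp only: add_divide_distrib diff_conv_add_uminus *[OF of_nat_0_le_iff C, unfolded diff_conv_add_uminus])
    qed
    also have "\<dots> = bin_entropy (true_frac \<psi> e ?C)"
    proof -
      have "?C \<noteq> {}" using agree_self[OF v] by blast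
      then show ?thesis
        unfolding bin_entropy_def by (simp add: true_frac_Not finite_agree) (simp add: true_frac_def)
    qed
    finally show "(\<Sum>u\<in>?C. ?F u) / card ?C = bin_entropy (true_frac \<psi> e ?C)" .
  qed
  finally show ?thesis .
qed

lemma entropy_insert_lipschitz: "\<bar>entropy \<psi> n (insert e S) - entropy \<psi> n S\<bar> \<le> 1"
proof -
  let ?h = "\<lambda>v. bin_entropy (true_frac \<psi> e (agree \<psi> n S v))"
  have "avg n (\<lambda>_. 0) \<le> avg n ?h" "avg n ?h \<le> avg n (\<lambda>_. 1)"
    by (intro avg_mono bin_entropy_bounds true_frac_bounds finite_agree)+
  then show ?thesis
    using entropy_drop[of \<psi> n S e] by (simp add: avg_const)
qed

lemma mult_ln_square_le:
  fixes x :: real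
  assumes "0 < x" "x \<le> 1"
  shows "x * (ln x)\<^sup>2 \<le> 2"
proof -
  let ?t = "- ln x"
  have "0 \<le> ?t" using assms by simp
  then have "1 + ?t + ?t\<^sup>2 / 2 \<le> exp ?t" by (rule exp_lower_Taylor_quadratic)
  moreover have "exp ?t = 1 / x" using assms by (simp add: exp_minus inverse_eq_divide)
  ultimately have "?t\<^sup>2 / 2 \<le> 1 / x" using \<open>0 \<le> ?t\<close> by linarith
  then show ?thesis using assms by (simp add: field_simps)
qed

text \<open>
  The clauses in \<open>S - T\<close> split every class of size \<open>c\<close> into at most \<open>2 ^ card (S - T)\<close> pieces.  A piece of
  relative size \<open>x\<close> contributes \<open>c * x * (ln x)\<^sup>2\<close>, and this is at most \<open>2 * c\<close> however small \<open>x\<close> is.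
\<close>

lemma log_ratio_second_moment:
  assumes "T \<subseteq> S" "finite S"
  shows "avg n (\<lambda>v. (ln (real (card (agree \<psi> n S v))) - ln (real (card (agree \<psi> n T v))))\<^sup>2)
      \<le> 2 * 2 ^ card (S - T)"
proof -
  let ?F = "\<lambda>v. (ln (real (card (agree \<psi> n S v))) - ln (real (card (agree \<psi> n T v))))\<^sup>2"
  have "avg n ?F = avg n (\<lambda>v. (\<Sum>u\<in>agree \<psi> n T v. ?F u) / card (agree \<psi> n T v))"
    by (rule avg_agree_mean)
  also have "\<dots> \<le> avg n (\<lambda>_. 2 * 2 ^ card (S - T))"
  proof (rule avg_mono)
    fix v assume v: "v \<in> cube n"
    let ?C = "agree \<psi> n T v"
    let ?lab = "\<lambda>u. {e \<in> S - T. \<psi> (restrict_to u e)}"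
    have C: "0 < real (card ?C)" using v by (simp add: card_agree_pos)
    have fin: "finite ?C" by (rule finite_agree)
    have "(\<Sum>u\<in>?C. ?F u) = (\<Sum>L\<in>Pow (S - T). \<Sum>u\<in>{u \<in> ?C. ?lab u = L}. ?F u)"
      using assms by (subst sum.group) (auto simp: fin)
    also have "\<dots> \<le> (\<Sum>L\<in>Pow (S - T). 2 * real (card ?C))"
    proof (rule sum_mono)
      fix L assume "L \<in> Pow (S - T)"
      \<comment> \<open>A nonempty fibre of the labelling is a class for \<open>S\<close>.\<close>
      let ?D = "{u \<in> ?C. ?lab u = L}"
      have sub: "?D \<subseteq> ?C" by auto
      have D: "agree \<psi> n S u = ?D" if u: "u \<in> ?D" for u
      proof -
        have "(\<forall>e\<in>S. \<psi> (restrict_to y e) = \<psi> (restrict_to u e))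
            \<longleftrightarrow> (\<forall>e\<in>T. \<psi> (restrict_to y e) = \<psi> (restrict_to u e)) \<and> ?lab y = ?lab u" for y
          using assms(1) by blast
        then have "agree \<psi> n S u = {y \<in> agree \<psi> n T u. ?lab y = ?lab u}"
          unfolding agree_def by blast
        also have "\<dots> = ?D" using u agree_eq[of u \<psi> n T v] by auto
        finally show ?thesis .
      qed
      show "(\<Sum>u\<in>?D. ?F u) \<le> 2 * real (card ?C)"
      proof (cases "?D = {}")
        case False
        let ?x = "real (card ?D) / real (card ?C)"
        have pos: "0 < real (card ?D)" using False fin sub finite_subset by (fastforce simp: card_gt_0_iff)
        have x: "0 < ?x" "?x \<le> 1"
          using pos C card_mono[OF fin sub] by (auto simp: divide_le_eq)
        have "(\<Sum>u\<in>?D. ?F u) = (\<Sum>u\<in>?D. (ln ?x)\<^sup>2)"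
        proof (intro sum.cong refl)
          fix u assume u: "u \<in> ?D"
          then have "agree \<psi> n T u = ?C" using agree_eq[of u \<psi> n T v] by auto
          then show "?F u = (ln ?x)\<^sup>2" using pos C by (simp only: D[OF u]) (simp add: ln_div)
        qed
        also have "\<dots> = real (card ?C) * (?x * (ln ?x)\<^sup>2)" using C by simp
        also have "\<dots> \<le> real (card ?C) * 2"
          using x by (intro mult_left_mono mult_ln_square_le) auto
        finally show ?thesis by simp
      next
        case True
        show ?thesis unfolding True by simp
      qed
    qed
    also have "\<dots> = 2 * 2 ^ card (S - T) * real (card ?C)"
      using assms by (simp add: card_Pow)
    finally show "(\<Sum>u\<in>?C. ?F u) / card ?C \<le> 2 * 2 ^ card (S - T)"
      using C by (simp add: divide_le_eq)
  qed
  also have "\<dots> = 2 * 2 ^ card (S - T)" by (rule avg_const)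
  finally show ?thesis .
qed

section \<open>Concavity of the mean label entropy under Hypothesis H\<close>

text \<open>
  The logarithmic series gives the values \<open>x < 1\<close>.  At \<open>x = 1\<close> the series telescopes, and the right-hand
  side is 1 because of the convention \<open>ln 0 = 0\<close>; the labels that all solutions share make this
  endpoint necessary.
\<close>

lemma sums_one_minus_ln:
  fixes x :: real
  assumes "0 \<le> x" "x \<le> 1"
  shows "(\<lambda>l. x ^ (l + 2) / ((real l + 1) * (real l + 2))) sums (x + (1 - x) * ln (1 - x))"
proof (cases "x = 1")
  case True
  have "(\<lambda>l. 1 / (real l + 1)) \<longlonglongrightarrow> 0" by real_asymp
  from telescope_sums'[OF this] show ?thesis
    using True by (simp add: field_simps)
next
  case False
  with assms have x: "\<bar>- x\<bar> < 1" by simp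
  have "(\<lambda>n. x ^ n / real n) sums - ln (1 - x)"
    using sums_minus[OF ln_series'[OF x]] by simp
  then have a: "(\<lambda>n. x ^ (n + 1) / (real n + 1)) sums - ln (1 - x)"
    using sums_Suc_iff[of "\<lambda>n. x ^ n / real n" "- ln (1 - x)"] by (simp add: add.commute)
  then have b: "(\<lambda>n. x ^ (n + 2) / (real n + 2)) sums (- ln (1 - x) - x)"
    using sums_Suc_iff[of "\<lambda>n. x ^ (n + 1) / (real n + 1)" "- ln (1 - x) - x"]
    by (simp add: add.commute)
  have "(\<lambda>n. x * (x ^ (n + 1) / (real n + 1)) - x ^ (n + 2) / (real n + 2))
      sums (x * - ln (1 - x) - (- ln (1 - x) - x))"
    by (intro sums_diff sums_mult a b)
  then show ?thesis by (simp add: field_simps)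
qed

text \<open>
  In this expansion of the entropy all coefficients have the same sign, and \<open>p ^ l + (1 - p) ^ l\<close> is the
  probability that \<open>l\<close> independent labels coincide.  Hypothesis H controls exactly these
  probabilities.
\<close>

lemma bin_entropy_sums:
  assumes "0 \<le> p" "p \<le> 1"
  shows "(\<lambda>l. (p ^ (l + 2) + (1 - p) ^ (l + 2)) / ((real l + 1) * (real l + 2)))
    sums (1 - bin_entropy p)"
proof -
  have "(\<lambda>l. p ^ (l + 2) / ((real l + 1) * (real l + 2))
        + (1 - p) ^ (l + 2) / ((real l + 1) * (real l + 2)))
      sums (p + (1 - p) * ln (1 - p) + (1 - p + (1 - (1 - p)) * ln (1 - (1 - p))))"
    using assms by (intro sums_add sums_one_minus_ln) auto
  also have "p + (1 - p) * ln (1 - p) + (1 - p + (1 - (1 - p)) * ln (1 - (1 - p)))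
      = 1 - bin_entropy p"
    by (simp add: bin_entropy_def)
  finally show ?thesis by (simp only: add_divide_distrib)
qed

definition tuples :: "nat \<Rightarrow> nat set \<Rightarrow> nat list set" where
  "tuples k J = {e. length e = k \<and> set e \<subseteq> J}"

lemma finite_tuples: "finite J \<Longrightarrow> finite (tuples k J)"
  using finite_lists_length_eq[of J k] by (simp add: tuples_def conj_commute)

lemma card_tuples: "finite J \<Longrightarrow> card (tuples k J) = card J ^ k"
  using card_lists_length_eq[of J k] by (simp add: tuples_def conj_commute)

lemma card_lists_nth:
  assumes "\<And>i. i < k \<Longrightarrow> finite (A i)"
  shows "card {e. length e = k \<and> (\<forall>i<k. e ! i \<in> A i)} = (\<Prod>i<k. card (A i))"
  using assms
proof (induction k arbitrary: A)
  case (Suc k)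
  let ?L = "{e. length e = k \<and> (\<forall>i<k. e ! i \<in> A (Suc i))}"
  have "{e. length e = Suc k \<and> (\<forall>i<Suc k. e ! i \<in> A i)} = (\<lambda>(a, e). a # e) ` (A 0 \<times> ?L)"
    by (auto simp: length_Suc_conv All_less_Suc2 image_iff)
  moreover have "inj_on (\<lambda>(a, e). a # e) (A 0 \<times> ?L)" by (auto simp: inj_on_def)
  ultimately show ?case
    using Suc.IH[of "\<lambda>i. A (Suc i)"] Suc.prems
    by (simp add: card_image card_cartesian_product prod.lessThan_Suc_shift del: prod.lessThan_Suc)
qed (simp add: conj_commute)

lemma card_eq_sum_fibres:
  assumes "finite T" "finite M"
  shows "card {e \<in> T. g e \<in> M} = (\<Sum>W\<in>M. card {e \<in> T. g e = W})"
proof -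
  have "(\<Sum>W\<in>M. sum (\<lambda>_. 1::nat) {e \<in> {e \<in> T. g e \<in> M}. g e = W}) = sum (\<lambda>_. 1) {e \<in> T. g e \<in> M}"
    using assms by (intro sum.group) auto
  moreover have "{e \<in> {e \<in> T. g e \<in> M}. g e = W} = {e \<in> T. g e = W}" if "W \<in> M" for W
    using that by auto
  ultimately show ?thesis by simp
qed

text \<open>
  The empirical law of the columns, indexed by \<open>J\<close>, of the matrix whose rows are the assignments in \<open>U\<close>, as a point of the
  space on which Hypothesis H is stated.
\<close>

definition column_law :: "bool list list \<Rightarrow> nat set \<Rightarrow> (bool list \<Rightarrow>\<^sub>0 real)" where
  "column_law U J = Abs_poly_mapping (\<lambda>x. card {j \<in> J. map (\<lambda>u. u ! j) U = x} / card J)"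

lemma lookup_column_law:
  assumes "finite J"
  shows "Poly_Mapping.lookup (column_law U J) x = card {j \<in> J. map (\<lambda>u. u ! j) U = x} / card J"
proof -
  have "{x. card {j \<in> J. map (\<lambda>u. u ! j) U = x} / real (card J) \<noteq> 0} \<subseteq> (\<lambda>j. map (\<lambda>u. u ! j) U) ` J"
    using assms by auto
  then have "finite {x. card {j \<in> J. map (\<lambda>u. u ! j) U = x} / real (card J) \<noteq> 0}"
    using assms by (rule finite_subset[OF _ finite_imageI])
  then show ?thesis by (simp add: column_law_def Abs_poly_mapping_inverse)
qed

lemma column_law_prob_measure:
  assumes "finite J" "J \<noteq> {}" "length U = l"
  shows "column_law U J \<in> prob_measures l"
proof -
  let ?c = "\<lambda>j. map (\<lambda>u. u ! j) U"
  have "Poly_Mapping.keys (column_law U J) \<subseteq> cube l"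
    using assms by (auto simp: in_keys_iff lookup_column_law cube_def)
  moreover have "(\<Sum>x\<in>cube l. Poly_Mapping.lookup (column_law U J) x) = 1"
  proof -
    have "card J = (\<Sum>x\<in>cube l. card {j \<in> J. ?c j = x})"
      using card_eq_sum_fibres[OF assms(1) finite_cube, of ?c l] assms(3) by (simp add: cube_def)
    then have sum: "(\<Sum>x\<in>cube l. real (card {j \<in> J. ?c j = x})) = real (card J)" by simp
    have "(\<Sum>x\<in>cube l. Poly_Mapping.lookup (column_law U J) x)
        = (\<Sum>x\<in>cube l. real (card {j \<in> J. ?c j = x})) / real (card J)"
      using assms(1) by (simp add: lookup_column_law sum_divide_distrib)
    then show ?thesis unfolding sum using assms by simp
  qed
  ultimately show ?thesis
    using assms by (auto simp: prob_measures_def lookup_column_law)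
qed

lemma column_law_Un:
  assumes "finite J1" "finite J2" "J1 \<noteq> {}" "J2 \<noteq> {}" "J1 \<inter> J2 = {}"
  shows "column_law U (J1 \<union> J2) = (card J1 / card (J1 \<union> J2)) *\<^sub>R column_law U J1
    + (card J2 / card (J1 \<union> J2)) *\<^sub>R column_law U J2"
proof (rule poly_mapping_eqI)
  fix x
  let ?c = "\<lambda>J. card {j \<in> J. map (\<lambda>u. u ! j) U = x}"
  have "{j \<in> J1 \<union> J2. map (\<lambda>u. u ! j) U = x}
      = {j \<in> J1. map (\<lambda>u. u ! j) U = x} \<union> {j \<in> J2. map (\<lambda>u. u ! j) U = x}" by auto
  then have "?c (J1 \<union> J2) = ?c J1 + ?c J2"
    using assms by (simp add: card_Un_disjoint disjoint_iff)
  moreover have "real (card J1) \<noteq> 0" "real (card J2) \<noteq> 0" using assms by auto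
  ultimately show "Poly_Mapping.lookup (column_law U (J1 \<union> J2)) x
      = Poly_Mapping.lookup ((card J1 / card (J1 \<union> J2)) *\<^sub>R column_law U J1
    + (card J2 / card (J1 \<union> J2)) *\<^sub>R column_law U J2) x"
    using assms by (simp add: lookup_add lookup_scaleR lookup_column_law add_divide_distrib)
qed

definition same_value :: "(bool list \<Rightarrow> bool) \<Rightarrow> bool list list \<Rightarrow> nat list \<Rightarrow> bool" where
  "same_value \<psi> U e \<longleftrightarrow> (\<forall>u\<in>set U. \<forall>u'\<in>set U. \<psi> (restrict_to u e) = \<psi> (restrict_to u' e))"

text \<open>
  The entries of a uniform tuple in \<open>tuples k J\<close> are independent uniform elements of \<open>J\<close>, so the
  columns of \<open>U\<close> that it selects are \<open>k\<close> independent samples of the column law.  This product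
  structure is the reason for admitting repeated variables.
\<close>

lemma Gamma_fun_column_law:
  assumes "finite J" "length U = l"
  shows "2 * Gamma_fun k \<psi> l (column_law U J) = card {e \<in> tuples k J. same_value \<psi> U e} / card J ^ k"
proof -
  let ?M = "{W. length W = l \<and> set W \<subseteq> cube k \<and> (\<forall>u \<in> set W. \<forall>u' \<in> set W. \<psi> u = \<psi> u')}"
  let ?g = "\<lambda>e. map (\<lambda>u. restrict_to u e) U"
  have "?M \<subseteq> {W. set W \<subseteq> cube k \<and> length W = l}" by auto
  then have fin: "finite ?M"
    using finite_lists_length_eq[OF finite_cube] by (rule finite_subset)
  have W: "(\<Prod>i<k. Poly_Mapping.lookup (column_law U J) (map (\<lambda>w. w ! i) W))
      = card {e \<in> tuples k J. ?g e = W} / card J ^ k" if "W \<in> ?M" for W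
  proof -
    let ?A = "\<lambda>i. {j \<in> J. map (\<lambda>u. u ! j) U = map (\<lambda>w. w ! i) W}"
    have "?g e = W \<longleftrightarrow> (\<forall>i<k. map (\<lambda>u. u ! (e ! i)) U = map (\<lambda>w. w ! i) W)" if "length e = k" for e
    proof -
      have len: "length (W ! r) = k" if "r < l" for r
        using \<open>W \<in> ?M\<close> that nth_mem[of r W] by (auto simp: cube_def simp del: nth_mem)
      have "?g e = W \<longleftrightarrow> (\<forall>r<l. restrict_to (U ! r) e = W ! r)"
        using \<open>W \<in> ?M\<close> assms(2) by (auto simp: list_eq_iff_nth_eq)
      also have "\<dots> \<longleftrightarrow> (\<forall>r<l. \<forall>i<k. U ! r ! (e ! i) = W ! r ! i)"
        using len \<open>length e = k\<close> by (auto simp: list_eq_iff_nth_eq restrict_to_def)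
      also have "\<dots> \<longleftrightarrow> (\<forall>i<k. map (\<lambda>u. u ! (e ! i)) U = map (\<lambda>w. w ! i) W)"
        using \<open>W \<in> ?M\<close> assms(2) by (auto simp: list_eq_iff_nth_eq)
      finally show ?thesis .
    qed
    then have "{e \<in> tuples k J. ?g e = W} = {e. length e = k \<and> (\<forall>i<k. e ! i \<in> ?A i)}"
      by (auto simp: tuples_def set_conv_nth)
    then have "card {e \<in> tuples k J. ?g e = W} = (\<Prod>i<k. card (?A i))"
      using card_lists_nth[of k ?A] assms(1) by simp
    then show ?thesis
      using assms(1) by (simp add: lookup_column_law prod_dividef)
  qed
  have "2 * Gamma_fun k \<psi> l (column_law U J) = (\<Sum>W\<in>?M. card {e \<in> tuples k J. ?g e = W} / card J ^ k)"
  proof -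
    have "2 * Gamma_fun k \<psi> l (column_law U J)
        = (\<Sum>W\<in>?M. \<Prod>i<k. Poly_Mapping.lookup (column_law U J) (map (\<lambda>w. w ! i) W))"
      by (simp add: Gamma_fun_def)
    also have "\<dots> = (\<Sum>W\<in>?M. card {e \<in> tuples k J. ?g e = W} / card J ^ k)"
      by (rule sum.cong[OF refl W])
    finally show ?thesis .
  qed
  also have "\<dots> = card {e \<in> tuples k J. ?g e \<in> ?M} / card J ^ k"
    using card_eq_sum_fibres[OF finite_tuples[OF assms(1)] fin, of k ?g]
    by (simp flip: sum_divide_distrib)
  also have "{e \<in> tuples k J. ?g e \<in> ?M} = {e \<in> tuples k J. same_value \<psi> U e}"
    using assms(2) by (auto simp: same_value_def tuples_def cube_def restrict_to_def)
  finally show ?thesis .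
qed

text \<open>
  The probability that \<open>l\<close> independent uniform elements of \<open>C\<close> give the same label to a uniform tuple
  in \<open>J\<close>; see \<open>replica_mean_eq\<close>.
\<close>

definition replica_mean :: "nat \<Rightarrow> (bool list \<Rightarrow> bool) \<Rightarrow> bool list set \<Rightarrow> nat \<Rightarrow> nat set \<Rightarrow> real" where
  "replica_mean k \<psi> C l J
     = (\<Sum>e\<in>tuples k J. true_frac \<psi> e C ^ l + (1 - true_frac \<psi> e C) ^ l) / card J ^ k"

lemma replica_mean_eq:
  assumes "finite C" "C \<noteq> {}" "finite J" "1 \<le> l"
  shows "replica_mean k \<psi> C l J
    = (\<Sum>U\<in>{U. set U \<subseteq> C \<and> length U = l}. 2 * Gamma_fun k \<psi> l (column_law U J)) / card C ^ l"
proof -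
  let ?R = "{U. set U \<subseteq> C \<and> length U = l}"
  have fin: "finite ?R" by (rule finite_lists_length_eq[OF assms(1)])
  \<comment> \<open>The two powers count disjoint sets of lists, as \<open>l \<ge> 1\<close> excludes the empty list, which would be
    counted in both.\<close>
  have e: "true_frac \<psi> e C ^ l + (1 - true_frac \<psi> e C) ^ l
      = card {U \<in> ?R. same_value \<psi> U e} / card C ^ l" for e
  proof -
    let ?D = "\<lambda>b. {y \<in> C. \<psi> (restrict_to y e) = b}"
    let ?S = "\<lambda>b. {U. set U \<subseteq> ?D b \<and> length U = l}"
    have "{U \<in> ?R. same_value \<psi> U e} = ?S True \<union> ?S False"
      by (auto simp: same_value_def)
    moreover have "?S True \<inter> ?S False = {}"
    proof -
      have False if "U \<in> ?S True" "U \<in> ?S False" for U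
      proof -
        have "hd U \<in> set U" using that assms(4) by (intro hd_in_set) auto
        then show False using that by auto
      qed
      then show ?thesis by blast
    qed
    ultimately have "card {U \<in> ?R. same_value \<psi> U e} = card (?S True) + card (?S False)"
      using assms(1) by (simp add: card_Un_disjoint finite_lists_length_eq)
    also have "\<dots> = card (?D True) ^ l + card (?D False) ^ l"
      using assms(1) by (simp add: card_lists_length_eq)
    finally show ?thesis
      using assms(1,2)
      by (simp add: true_frac_Not) (simp add: true_frac_def power_divide add_divide_distrib)
  qed
  have "(\<Sum>e\<in>tuples k J. card {U \<in> ?R. same_value \<psi> U e})
      = (\<Sum>U\<in>?R. card {e \<in> tuples k J. same_value \<psi> U e})"
    using sum_multicount_gen[OF finite_tuples[OF assms(3), of k] fin, of "\<lambda>e U. same_value \<psi> U e"] by auto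
  then have swap: "(\<Sum>e\<in>tuples k J. real (card {U \<in> ?R. same_value \<psi> U e}))
      = (\<Sum>U\<in>?R. real (card {e \<in> tuples k J. same_value \<psi> U e}))"
    by (simp flip: of_nat_sum)
  have "replica_mean k \<psi> C l J
      = (\<Sum>e\<in>tuples k J. real (card {U \<in> ?R. same_value \<psi> U e})) / card C ^ l / card J ^ k"
    unfolding replica_mean_def e by (simp flip: sum_divide_distrib)
  also have "\<dots> = (\<Sum>U\<in>?R. card {e \<in> tuples k J. same_value \<psi> U e} / card J ^ k) / card C ^ l"
    unfolding swap by (simp add: sum_divide_distrib mult.commute)
  also have "\<dots> = (\<Sum>U\<in>?R. 2 * Gamma_fun k \<psi> l (column_law U J)) / card C ^ l"
    using assms(3) by (simp add: Gamma_fun_column_law)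
  finally show ?thesis .
qed

text \<open>
  For a fixed list of assignments, the column law on a disjoint union is the mixture of the laws on the
  parts; Hypothesis H applies to it.
\<close>

lemma replica_mean_convex:
  assumes "hypothesis_H k \<psi>" "finite C" "C \<noteq> {}" "1 \<le> l"
    and J: "finite J1" "finite J2" "J1 \<noteq> {}" "J2 \<noteq> {}" "J1 \<inter> J2 = {}"
  defines "w \<equiv> \<lambda>J. card J / card (J1 \<union> J2)"
  shows "replica_mean k \<psi> C l (J1 \<union> J2) \<le> w J1 * replica_mean k \<psi> C l J1 + w J2 * replica_mean k \<psi> C l J2"
proof -
  let ?R = "{U. set U \<subseteq> C \<and> length U = l}"
  let ?G = "\<lambda>U J. Gamma_fun k \<psi> l (column_law U J)"
  have w: "0 \<le> w J1" "0 \<le> w J2" "w J1 + w J2 = 1"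
    using J by (auto simp: w_def card_Un_disjoint simp flip: add_divide_distrib of_nat_add)
  have "?G U (J1 \<union> J2) \<le> w J1 * ?G U J1 + w J2 * ?G U J2" if "U \<in> ?R" for U
  proof -
    have "convex_on (prob_measures l) (Gamma_fun k \<psi> l)"
      using assms(1,4) by (simp add: hypothesis_H_def)
    moreover have "column_law U J1 \<in> prob_measures l" "column_law U J2 \<in> prob_measures l"
      using that J by (auto intro: column_law_prob_measure)
    ultimately have "Gamma_fun k \<psi> l (w J1 *\<^sub>R column_law U J1 + w J2 *\<^sub>R column_law U J2)
        \<le> w J1 * ?G U J1 + w J2 * ?G U J2"
      using w by (simp add: convex_on_def)
    then show ?thesis by (simp only: column_law_Un[OF J] w_def)
  qed
  then have "2 * ?G U (J1 \<union> J2) \<le> w J1 * (2 * ?G U J1) + w J2 * (2 * ?G U J2)" if "U \<in> ?R" for U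
    using that by fastforce
  then have "(\<Sum>U\<in>?R. 2 * ?G U (J1 \<union> J2)) \<le> (\<Sum>U\<in>?R. w J1 * (2 * ?G U J1) + w J2 * (2 * ?G U J2))"
    by (rule sum_mono)
  also have "\<dots> = w J1 * (\<Sum>U\<in>?R. 2 * ?G U J1) + w J2 * (\<Sum>U\<in>?R. 2 * ?G U J2)"
    by (simp only: sum.distrib sum_distrib_left)
  finally have "(\<Sum>U\<in>?R. 2 * ?G U (J1 \<union> J2)) / card C ^ l
      \<le> (w J1 * (\<Sum>U\<in>?R. 2 * ?G U J1) + w J2 * (\<Sum>U\<in>?R. 2 * ?G U J2)) / card C ^ l"
    by (rule divide_right_mono) simp
  then show ?thesis
    using assms J by (simp add: replica_mean_eq add_divide_distrib)
qed

definition mean_clause_entropy :: "nat \<Rightarrow> (bool list \<Rightarrow> bool) \<Rightarrow> bool list set \<Rightarrow> nat set \<Rightarrow> real" where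
  "mean_clause_entropy k \<psi> C J
     = (\<Sum>e\<in>tuples k J. bin_entropy (true_frac \<psi> e C)) / card J ^ k"

lemma mean_clause_entropy_sums:
  assumes "finite C" "finite J" "J \<noteq> {}"
  shows "(\<lambda>l. replica_mean k \<psi> C (l + 2) J / ((real l + 1) * (real l + 2)))
    sums (1 - mean_clause_entropy k \<psi> C J)"
proof -
  have J: "real (card J ^ k) \<noteq> 0" using assms by simp
  have "(\<lambda>l. (\<Sum>e\<in>tuples k J. (true_frac \<psi> e C ^ (l + 2) + (1 - true_frac \<psi> e C) ^ (l + 2))
        / ((real l + 1) * (real l + 2))) / card J ^ k)
      sums ((\<Sum>e\<in>tuples k J. 1 - bin_entropy (true_frac \<psi> e C)) / card J ^ k)"
    by (intro sums_divide sums_sum bin_entropy_sums true_frac_bounds assms)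
  also have "(\<Sum>e\<in>tuples k J. 1 - bin_entropy (true_frac \<psi> e C)) / card J ^ k
      = 1 - mean_clause_entropy k \<psi> C J"
    using J assms by (simp add: mean_clause_entropy_def sum_subtractf card_tuples diff_divide_distrib)
  finally show ?thesis
    unfolding replica_mean_def by (simp add: mult.commute flip: sum_divide_distrib)
qed

text \<open>
  The convexity of every replica mean, summed against the positive coefficients of the entropy
  expansion.
\<close>

lemma mean_clause_entropy_concave:
  assumes "hypothesis_H k \<psi>" "finite C" "C \<noteq> {}"
    and J: "finite J1" "finite J2" "J1 \<noteq> {}" "J2 \<noteq> {}" "J1 \<inter> J2 = {}"
  shows "card J1 * mean_clause_entropy k \<psi> C J1 + card J2 * mean_clause_entropy k \<psi> C J2
    \<le> card (J1 \<union> J2) * mean_clause_entropy k \<psi> C (J1 \<union> J2)"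
proof -
  let ?w = "\<lambda>J. card J / card (J1 \<union> J2)" and ?h = "mean_clause_entropy k \<psi> C"
  let ?r = "\<lambda>J l. replica_mean k \<psi> C (l + 2) J / ((real l + 1) * (real l + 2))"
  have "1 - ?h (J1 \<union> J2) \<le> ?w J1 * (1 - ?h J1) + ?w J2 * (1 - ?h J2)"
  proof (rule sums_le)
    show "?r (J1 \<union> J2) sums (1 - ?h (J1 \<union> J2))"
      using assms by (intro mean_clause_entropy_sums) auto
    show "(\<lambda>l. ?w J1 * ?r J1 l + ?w J2 * ?r J2 l) sums (?w J1 * (1 - ?h J1) + ?w J2 * (1 - ?h J2))"
      using assms by (intro sums_add sums_mult mean_clause_entropy_sums) auto
    show "?r (J1 \<union> J2) l \<le> ?w J1 * ?r J1 l + ?w J2 * ?r J2 l" for l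
    proof -
      have "?r (J1 \<union> J2) l \<le> (?w J1 * replica_mean k \<psi> C (l + 2) J1 + ?w J2 * replica_mean k \<psi> C (l + 2) J2)
          / ((real l + 1) * (real l + 2))"
        using assms by (intro divide_right_mono replica_mean_convex) auto
      then show ?thesis by (simp add: add_divide_distrib)
    qed
  qed
  moreover have card: "card (J1 \<union> J2) = card J1 + card J2" "card (J1 \<union> J2) \<noteq> 0"
    using J by (auto simp: card_Un_disjoint)
  ultimately have "real (card (J1 \<union> J2)) * (1 - ?h (J1 \<union> J2))
      \<le> real (card (J1 \<union> J2)) * (?w J1 * (1 - ?h J1) + ?w J2 * (1 - ?h J2))"
    by (intro mult_left_mono) auto
  also have "\<dots> = card J1 * (1 - ?h J1) + card J2 * (1 - ?h J2)"
    using card(2) by (simp add: distrib_left)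
  finally show ?thesis
    using card(1) by (simp add: algebra_simps)
qed

section \<open>Subadditivity by interpolation\<close>

lemma bin_entropy_tuples_sum:
  fixes \<alpha> :: real
  assumes "finite J" "J \<noteq> {}"
  shows "(\<Sum>e\<in>tuples k J. \<alpha> * card J / card J ^ k * bin_entropy (true_frac \<psi> e C))
    = \<alpha> * (card J * mean_clause_entropy k \<psi> C J)"
  by (simp add: mean_clause_entropy_def sum_distrib_left sum_divide_distrib mult.assoc)

lemma restrict_to_append:
  assumes "length y = m"
  shows "set e \<subseteq> {..<m} \<Longrightarrow> restrict_to (y @ z) e = restrict_to y e"
    and "restrict_to (y @ z) (map ((+) m) e) = restrict_to z e"
  using assms by (auto simp: restrict_to_def nth_append)

lemma cube_append: "cube (m + n) = (\<lambda>(y, z). y @ z) ` (cube m \<times> cube n)"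
proof
  show "cube (m + n) \<subseteq> (\<lambda>(y, z). y @ z) ` (cube m \<times> cube n)"
  proof
    fix x :: "bool list" assume "x \<in> cube (m + n)"
    then have "x = (\<lambda>(y, z). y @ z) (take m x, drop m x)" "(take m x, drop m x) \<in> cube m \<times> cube n"
      by (auto simp: cube_def)
    then show "x \<in> (\<lambda>(y, z). y @ z) ` (cube m \<times> cube n)" by (rule image_eqI)
  qed
qed (auto simp: cube_def)

lemma inj_on_append_cube: "A \<subseteq> cube m \<Longrightarrow> inj_on (\<lambda>(y, z). y @ z) (A \<times> B)"
  by (auto simp: inj_on_def cube_def subset_iff)

lemma avg_append: "avg (m + n) F = avg m (\<lambda>y. avg n (\<lambda>z. F (y @ z)))"
  unfolding avg_def cube_append
  by (subst sum.reindex[OF inj_on_append_cube[OF order_refl]])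
     (simp add: sum.cartesian_product power_add case_prod_beta mult.commute flip: sum_divide_distrib)

lemma agree_append:
  assumes "S \<subseteq> tuples k {..<m}" "y \<in> cube m"
  shows "agree \<psi> (m + n) (S \<union> map ((+) m) ` T) (y @ z)
    = (\<lambda>(y, z). y @ z) ` (agree \<psi> m S y \<times> agree \<psi> n T z)"
proof -
  have S: "restrict_to (a @ b) e = restrict_to a e" if "a \<in> cube m" "e \<in> S" for a b e
    using assms(1) that by (intro restrict_to_append) (auto simp: cube_def tuples_def)
  have T: "restrict_to (a @ b) (map ((+) m) e) = restrict_to b e" if "a \<in> cube m" for a b e
    using that by (intro restrict_to_append) (auto simp: cube_def)
  have iff: "(\<forall>e\<in>S \<union> map ((+) m) ` T. \<psi> (restrict_to (a @ b) e) = \<psi> (restrict_to (y @ z) e))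
      \<longleftrightarrow> (\<forall>e\<in>S. \<psi> (restrict_to a e) = \<psi> (restrict_to y e))
        \<and> (\<forall>e\<in>T. \<psi> (restrict_to b e) = \<psi> (restrict_to z e))" if "a \<in> cube m" for a b
    using that assms(2) by (simp add: ball_Un S T)
  have "{x \<in> (\<lambda>(y, z). y @ z) ` (cube m \<times> cube n). P x}
      = (\<lambda>(y, z). y @ z) ` ({a \<in> cube m. A a} \<times> {b \<in> cube n. B b})"
    if "\<And>a b. a \<in> cube m \<Longrightarrow> P (a @ b) \<longleftrightarrow> A a \<and> B b" for P A B
    using that by auto
  then show ?thesis
    unfolding agree_def cube_append using iff by this
qed

text \<open>
  Clauses on two disjoint blocks of variables impose independent constraints, so the numbers of
  solutions multiply.
\<close>

lemma entropy_append:
  assumes "S \<subseteq> tuples k {..<m}"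
  shows "entropy \<psi> (m + n) (S \<union> map ((+) m) ` T) = entropy \<psi> m S + entropy \<psi> n T"
proof -
  have "ln (real (card (agree \<psi> (m + n) (S \<union> map ((+) m) ` T) (y @ z))))
      = ln (real (card (agree \<psi> m S y))) + ln (real (card (agree \<psi> n T z)))"
    if "y \<in> cube m" "z \<in> cube n" for y z
    using card_agree_pos[OF that(1), of \<psi> S] card_agree_pos[OF that(2), of \<psi> T]
    by (simp add: agree_append[OF assms that(1)] card_image inj_on_append_cube[OF agree_subset]
        card_cartesian_product ln_mult)
  then have "entropy \<psi> (m + n) (S \<union> map ((+) m) ` T)
      = avg m (\<lambda>y. avg n (\<lambda>z. ln (real (card (agree \<psi> m S y))) + ln (real (card (agree \<psi> n T z)))))"
    unfolding entropy_def avg_append by (intro avg_cong) auto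
  then show ?thesis
    by (simp add: entropy_def avg_add avg_const)
qed

text \<open>
  The mean entropy when the edges arrive on all \<open>n ^ k\<close> tuples with total rate \<open>\<alpha> * n\<close>, repeated
  arrivals counting once.
\<close>

definition poisson_entropy :: "nat \<Rightarrow> (bool list \<Rightarrow> bool) \<Rightarrow> real \<Rightarrow> nat \<Rightarrow> real" where
  "poisson_entropy k \<psi> \<alpha> n
     = bmean (tuples k {..<n}) (\<lambda>_. 1 - exp (- (\<alpha> * real n / real n ^ k))) (entropy \<psi> n)"

lemma poisson_entropy_bounds:
  assumes "0 \<le> \<alpha>"
  shows "0 \<le> poisson_entropy k \<psi> \<alpha> n" "poisson_entropy k \<psi> \<alpha> n \<le> ln 2 * real n"
proof -
  have *: "bmean (tuples k {..<n}) (\<lambda>_. 1 - exp (- (\<alpha> * real n / real n ^ k))) (\<lambda>_. c) = c" for c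
    by (intro bmean_const finite_tuples) simp
  have q: "0 \<le> 1 - exp (- (\<alpha> * real n / real n ^ k)) \<and> 1 - exp (- (\<alpha> * real n / real n ^ k)) \<le> 1"
    using assms by (intro one_minus_exp_bounds) simp
  show "0 \<le> poisson_entropy k \<psi> \<alpha> n"
    unfolding poisson_entropy_def
    by (subst (1) *[of 0, symmetric]) (intro bmean_mono q entropy_nonneg)
  have "poisson_entropy k \<psi> \<alpha> n
      \<le> bmean (tuples k {..<n}) (\<lambda>_. 1 - exp (- (\<alpha> * real n / real n ^ k))) (\<lambda>_. real n * ln 2)"
    unfolding poisson_entropy_def by (intro bmean_mono q entropy_le)
  then show "poisson_entropy k \<psi> \<alpha> n \<le> ln 2 * real n"
    by (simp only: * mult.commute)
qed

text \<open>
  The two ends of the interpolation are the model on all \<open>m1 + m2\<close> variables and the union of the models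
  on two blocks.  The total rates agree, because the blocks receive the shares \<open>\<alpha> * m1\<close> and \<open>\<alpha> * m2\<close>,
  and these are the weights with which \<open>mean_clause_entropy_concave\<close> compares the effects.
\<close>

lemma poisson_entropy_subadditive:
  assumes H: "hypothesis_H k \<psi>" and "1 \<le> k" "0 \<le> \<alpha>" and m: "1 \<le> m1" "1 \<le> m2"
  shows "poisson_entropy k \<psi> \<alpha> (m1 + m2) \<le> poisson_entropy k \<psi> \<alpha> m1 + poisson_entropy k \<psi> \<alpha> m2"
proof -
  define n where "n = m1 + m2"
  define J1 where "J1 = {..<m1}"
  define J2 where "J2 = {m1..<n}"
  have J: "J1 \<union> J2 = {..<n}" "J1 \<inter> J2 = {}" "finite J1" "finite J2" "J1 \<noteq> {}" "J2 \<noteq> {}"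
    "card J1 = m1" "card J2 = m2"
    using m by (auto simp: J1_def J2_def n_def lessThan_empty_iff bot_nat_def)
  let ?A = "tuples k {..<n}" and ?T1 = "tuples k J1" and ?T2 = "tuples k J2"
  have finA: "finite ?A" by (simp add: finite_tuples)
  have T: "?T1 \<subseteq> ?A" "?T2 \<subseteq> ?A" unfolding J(1)[symmetric] by (auto simp: tuples_def)
  have T12: "?T1 \<inter> ?T2 = {}"
  proof -
    have False if "e \<in> ?T1" "e \<in> ?T2" for e
    proof -
      have "hd e \<in> set e" using that assms(2) by (intro hd_in_set) (auto simp: tuples_def)
      then show False using that J(2) by (auto simp: tuples_def)
    qed
    then show ?thesis by blast
  qed
  let ?r = "\<lambda>m. \<alpha> * real m / real m ^ k"
  \<comment> \<open>The rates at the start of the interpolation; at its end every tuple has rate \<open>?r n\<close>.\<close>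
  define x where "x = (\<lambda>e. (if e \<in> ?T1 then ?r m1 else 0) + (if e \<in> ?T2 then ?r m2 else 0))"
  let ?f = "entropy \<psi> n"
  have "bmean ?A (\<lambda>e. 1 - exp (- ?r n)) ?f \<le> bmean ?A (\<lambda>e. 1 - exp (- x e)) ?f"
  proof (rule bmean_rate_mono[OF finA])
    show "0 \<le> x e" "0 \<le> ?r n" for e using assms(3) by (auto simp: x_def)
  next
    fix S assume "S \<subseteq> ?A"
    let ?b = "\<lambda>v e. bin_entropy (true_frac \<psi> e (agree \<psi> n S v))"
    have "(\<Sum>e\<in>?A. (?r n - x e) * (?f (insert e S) - ?f S))
        = (\<Sum>e\<in>?A. avg n (\<lambda>v. (x e - ?r n) * ?b v e))"
    proof (intro sum.cong refl)
      fix e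
      have "?f (insert e S) - ?f S = - avg n (\<lambda>v. ?b v e)"
        using entropy_drop[of \<psi> n S e] by simp
      then show "(?r n - x e) * (?f (insert e S) - ?f S) = avg n (\<lambda>v. (x e - ?r n) * ?b v e)"
        by (simp only: avg_cmult) (simp add: algebra_simps)
    qed
    also have "\<dots> = avg n (\<lambda>v. \<Sum>e\<in>?A. (x e - ?r n) * ?b v e)"
      by (rule avg_sum[symmetric])
    also have "\<dots> \<le> avg n (\<lambda>_. 0)"
    proof (rule avg_mono)
      fix v assume v: "v \<in> cube n"
      let ?C = "agree \<psi> n S v"
      have "(\<Sum>e\<in>?A. x e * ?b v e)
          = (\<Sum>e\<in>?A. if e \<in> ?T1 then ?r m1 * ?b v e else 0) + (\<Sum>e\<in>?A. if e \<in> ?T2 then ?r m2 * ?b v e else 0)"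
        unfolding sum.distrib[symmetric] x_def by (intro sum.cong refl) (auto simp: algebra_simps)
      also have "\<dots> = (\<Sum>e\<in>?T1. ?r m1 * ?b v e) + (\<Sum>e\<in>?T2. ?r m2 * ?b v e)"
        using T finA by (simp only: sum.inter_restrict[symmetric] Int_absorb1)
      also have "\<dots> = \<alpha> * (m1 * mean_clause_entropy k \<psi> ?C J1 + m2 * mean_clause_entropy k \<psi> ?C J2)"
        using bin_entropy_tuples_sum[OF J(3,5), of \<alpha> k \<psi> ?C] bin_entropy_tuples_sum[OF J(4,6), of \<alpha> k \<psi> ?C]
        by (simp only: J(7,8) distrib_left of_nat_power)
      also have "\<dots> \<le> \<alpha> * (n * mean_clause_entropy k \<psi> ?C {..<n})"
        using mean_clause_entropy_concave[OF H finite_agree _ J(3-6) J(2), of \<psi> n S v] agree_self[OF v] assms(3)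
        by (intro mult_left_mono) (auto simp: J(1,7,8))
      also have "\<dots> = (\<Sum>e\<in>?A. ?r n * ?b v e)"
        using bin_entropy_tuples_sum[of "{..<n}" \<alpha> k \<psi> ?C] m by (auto simp: n_def lessThan_empty_iff)
      finally show "(\<Sum>e\<in>?A. (x e - ?r n) * ?b v e) \<le> 0"
        by (simp add: left_diff_distrib sum_subtractf)
    qed
    finally show "(\<Sum>e\<in>?A. (?r n - x e) * (?f (insert e S) - ?f S)) \<le> 0"
      by (simp add: avg_const)
  qed
  also have "\<dots> = bmean (?T1 \<union> ?T2) (\<lambda>e. 1 - exp (- x e)) ?f"
    using T by (intro bmean_restrict finA) (auto simp: x_def)
  also have "\<dots> = bmean ?T1 (\<lambda>e. 1 - exp (- x e)) (\<lambda>S. bmean ?T2 (\<lambda>e. 1 - exp (- x e)) (\<lambda>S'. ?f (S \<union> S')))"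
    using T12 by (intro bmean_Un finite_tuples J)
  also have "\<dots> = bmean ?T1 (\<lambda>e. 1 - exp (- ?r m1)) (\<lambda>S. bmean ?T2 (\<lambda>e. 1 - exp (- ?r m2)) (\<lambda>S'. ?f (S \<union> S')))"
    using T12 by (intro bmean_cong) (auto simp: x_def disjoint_iff)
  also have "?T2 = map ((+) m1) ` tuples k {..<m2}"
  proof
    show "?T2 \<subseteq> map ((+) m1) ` tuples k {..<m2}"
    proof
      fix e assume e: "e \<in> ?T2"
      then have "e = map ((+) m1) (map (\<lambda>i. i - m1) e)"
        by (auto simp: tuples_def J2_def map_idI subset_iff intro!: map_idI[symmetric])
      moreover have "map (\<lambda>i. i - m1) e \<in> tuples k {..<m2}"
        using e by (fastforce simp: tuples_def J2_def n_def subset_iff)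
      ultimately show "e \<in> map ((+) m1) ` tuples k {..<m2}" by (rule image_eqI)
    qed
  qed (fastforce simp: tuples_def J2_def n_def)
  also have "bmean ?T1 (\<lambda>e. 1 - exp (- ?r m1))
      (\<lambda>S. bmean (map ((+) m1) ` tuples k {..<m2}) (\<lambda>e. 1 - exp (- ?r m2)) (\<lambda>S'. ?f (S \<union> S')))
    = bmean ?T1 (\<lambda>e. 1 - exp (- ?r m1))
      (\<lambda>S. bmean (tuples k {..<m2}) (\<lambda>e. 1 - exp (- ?r m2)) (\<lambda>S'. entropy \<psi> m1 S + entropy \<psi> m2 S'))"
  proof (rule bmean_cong)
    fix S assume S: "S \<subseteq> ?T1"
    have "bmean (map ((+) m1) ` tuples k {..<m2}) (\<lambda>e. 1 - exp (- ?r m2)) (\<lambda>S'. ?f (S \<union> S'))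
        = bmean (tuples k {..<m2}) (\<lambda>e. 1 - exp (- ?r m2)) (\<lambda>S'. ?f (S \<union> map ((+) m1) ` S'))"
      by (rule bmean_image) (auto simp: finite_tuples inj_on_def)
    also have "\<dots> = bmean (tuples k {..<m2}) (\<lambda>e. 1 - exp (- ?r m2)) (\<lambda>S'. entropy \<psi> m1 S + entropy \<psi> m2 S')"
      unfolding n_def using S by (intro bmean_cong entropy_append refl) (simp add: J1_def)
    finally show "bmean (map ((+) m1) ` tuples k {..<m2}) (\<lambda>e. 1 - exp (- ?r m2)) (\<lambda>S'. ?f (S \<union> S'))
      = bmean (tuples k {..<m2}) (\<lambda>e. 1 - exp (- ?r m2)) (\<lambda>S'. entropy \<psi> m1 S + entropy \<psi> m2 S')" .
  qed (rule refl)
  also have "\<dots> = poisson_entropy k \<psi> \<alpha> m1 + poisson_entropy k \<psi> \<alpha> m2"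
    unfolding poisson_entropy_def by (simp add: bmean_add bmean_const finite_tuples J1_def)
  finally show ?thesis
    unfolding poisson_entropy_def[of k \<psi> \<alpha> "m1 + m2"] n_def .
qed

text \<open>
  Fekete's lemma, for sequences between 0 and a linear function; the linear bound takes care of the
  remainder of the division by the block length.
\<close>

lemma subadditive_limit:
  fixes a :: "nat \<Rightarrow> real"
  assumes nonneg: "\<And>n. 0 \<le> a n" and le: "\<And>n. a n \<le> c * real n"
    and sub: "\<And>m n. 1 \<le> m \<Longrightarrow> 1 \<le> n \<Longrightarrow> a (m + n) \<le> a m + a n"
  shows "convergent (\<lambda>n. a n / real n)"
proof -
  have a0: "a 0 = 0" using nonneg[of 0] le[of 0] by simp
  have sub': "a (m + n) \<le> a m + a n" for m n
    using sub[of m n] a0 by (cases "m = 0 \<or> n = 0") auto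
  have mult: "a (q * m + r) \<le> real q * a m + a r" for q m r
  proof (induction q)
    case (Suc q)
    have "a (Suc q * m + r) \<le> a m + a (q * m + r)" using sub'[of m "q * m + r"] by (simp add: add.assoc)
    then show ?case using Suc.IH by (simp add: algebra_simps)
  qed simp
  have c: "0 \<le> c" using nonneg[of 1] le[of 1] by simp
  let ?B = "(\<lambda>n. a n / real n) ` {1..}"
  define L where "L = Inf ?B"
  have bdd: "bdd_below ?B" by (rule bdd_belowI[of _ 0]) (auto simp: nonneg)
  have "(\<lambda>n. a n / real n) \<longlonglongrightarrow> L"
  proof (rule LIMSEQ_I)
    fix \<epsilon> :: real assume \<epsilon>: "0 < \<epsilon>"
    have "\<exists>x\<in>?B. x < L + \<epsilon> / 2"
      using cInf_lessD[of ?B "L + \<epsilon> / 2"] \<epsilon> by (auto simp: L_def)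
    then obtain m where m: "1 \<le> m" "a m / real m < L + \<epsilon> / 2" by auto
    obtain n0 :: nat where n0: "2 * real m * c / \<epsilon> < real n0" using reals_Archimedean2 by blast
    have "norm (a n / real n - L) < \<epsilon>" if n: "Suc n0 \<le> n" for n
    proof -
      have n_pos: "0 < real n" using n by simp
      have "L \<le> a n / real n" unfolding L_def using n by (intro cInf_lower bdd) auto
      moreover have "a n / real n < L + \<epsilon>"
      proof -
        have "a n \<le> real (n div m) * a m + a (n mod m)" using mult[of "n div m" m "n mod m"] by simp
        also have "a (n mod m) \<le> c * real m"
          using le[of "n mod m"] mult_left_mono[of "real (n mod m)" "real m" c] c m by simp
        also have "real (n div m) * a m = real (n div m * m) * (a m / real m)" using m by simp
        also have "\<dots> \<le> real n * (a m / real m)"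
          using nonneg[of m] by (intro mult_right_mono) (auto simp only: of_nat_le_iff div_times_less_eq_dividend zero_le_divide_iff of_nat_0_le_iff)
        finally have "a n / real n \<le> (real n * (a m / real m) + c * real m) / real n"
          using n_pos by (simp add: divide_right_mono)
        also have "\<dots> = a m / real m + c * real m / real n"
          using n_pos by (simp add: add_divide_distrib)
        also have "c * real m / real n < \<epsilon> / 2"
        proof -
          have "2 * real m * c / \<epsilon> < real n" using n0 n by linarith
          then have "2 * real m * c < real n * \<epsilon>" using \<epsilon> by (simp add: divide_less_eq)
          then show ?thesis using n_pos by (simp add: divide_less_eq mult.commute)
        qed
        finally show ?thesis using m(2) by linarith
      qed
      ultimately show ?thesis by simp
    qed
    then show "\<exists>n0. \<forall>n\<ge>n0. norm (a n / real n - L) < \<epsilon>" by blast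
  qed
  then show ?thesis by (rule convergentI)
qed

section \<open>Transfer to distinct variables and Bernoulli edges\<close>

lemma edges_subset_tuples: "edges k n \<subseteq> tuples k {..<n}"
  by (auto simp: edges_def tuples_def)

lemma finite_edges: "finite (edges k n)"
  using edges_subset_tuples finite_tuples by (rule finite_subset) simp

definition edge_density :: "nat \<Rightarrow> nat \<Rightarrow> real" where
  "edge_density k n = card (edges k n) / real n ^ k"

lemma edge_density_tendsto: "(\<lambda>n. edge_density k n) \<longlonglongrightarrow> 1"
proof -
  have "(\<lambda>n. (real n - real i) / real n) \<longlonglongrightarrow> 1" for i by real_asymp
  then have "(\<lambda>n. \<Prod>i=0..<k. (real n - real i) / real n) \<longlonglongrightarrow> (\<Prod>i=0..<k. 1)"
    by (intro tendsto_prod)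
  moreover have "edge_density k n = (\<Prod>i=0..<k. (real n - real i) / real n)" for n
    by (simp add: edge_density_def card_edges binomial_gbinomial gbinomial_prod_rev prod_dividef)
  ultimately show ?thesis by simp
qed

lemma sublinear_rate_tendsto:
  assumes "2 \<le> k"
  shows "(\<lambda>n. real n / real n ^ k) \<longlonglongrightarrow> 0"
proof (rule tendsto_sandwich[of "\<lambda>_. 0" _ _ "\<lambda>n. 1 / real n"])
  show "\<forall>\<^sub>F n in sequentially. real n / real n ^ k \<le> 1 / real n"
    using eventually_gt_at_top[of 0]
  proof eventually_elim
    case (elim n)
    then have "real n ^ 2 \<le> real n ^ k" using assms by (intro power_increasing) auto
    then have "real n / real n ^ k \<le> real n / real n ^ 2"
      using elim by (intro divide_left_mono) auto
    then show ?case using elim by (simp add: power2_eq_square)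
  qed
  show "(\<lambda>n. 1 / real n) \<longlonglongrightarrow> 0" by real_asymp
qed auto

lemma edge_prob_eq: "edge_prob k n \<alpha> = \<alpha> * real n / card (edges k n)"
  by (simp only: edge_prob_def card_edges)

lemma edge_prob_tendsto:
  assumes "2 \<le> k"
  shows "(\<lambda>n. edge_prob k n \<alpha>) \<longlonglongrightarrow> 0"
proof -
  have "(\<lambda>n. \<alpha> * (real n / real n ^ k) / edge_density k n) \<longlonglongrightarrow> \<alpha> * 0 / 1"
    by (intro tendsto_intros sublinear_rate_tendsto assms edge_density_tendsto) simp
  moreover have "\<forall>\<^sub>F n in sequentially. \<alpha> * (real n / real n ^ k) / edge_density k n = edge_prob k n \<alpha>"
    using eventually_gt_at_top[of 0]
    by eventually_elim (simp add: edge_prob_eq edge_density_def)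
  ultimately show ?thesis by (simp add: tendsto_cong)
qed

definition planted_entropy :: "nat \<Rightarrow> (bool list \<Rightarrow> bool) \<Rightarrow> real \<Rightarrow> nat \<Rightarrow> real" where
  "planted_entropy k \<psi> \<alpha> n = bmean (edges k n) (\<lambda>_. edge_prob k n \<alpha>) (entropy \<psi> n)"

text \<open>
  The Lipschitz bound is summed over all tuples.  On the edges, the two inclusion probabilities
  differ only to second order in the rate and through the proportion of tuples that are edges; the other
  tuples have total probability at most \<open>\<alpha> * n * (1 - edge_density k n)\<close>.
\<close>

lemma poisson_planted_entropy_diff:
  assumes "0 \<le> \<alpha>" "0 < n" "edges k n \<noteq> {}" "edge_prob k n \<alpha> \<le> 1"
  shows "\<bar>poisson_entropy k \<psi> \<alpha> n - planted_entropy k \<psi> \<alpha> n\<bar>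
    \<le> real n * (\<alpha>\<^sup>2 * (real n / real n ^ k) + 2 * \<alpha> * (1 - edge_density k n))"
proof -
  let ?A = "tuples k {..<n}" and ?E = "edges k n"
  define p where "p = edge_prob k n \<alpha>"
  define r where "r = \<alpha> * real n / real n ^ k"
  define q where "q = 1 - exp (- r)"
  define N where "N = real (card ?E)"
  define M where "M = real n ^ k"
  have fin: "finite ?A" by (simp add: finite_tuples)
  have M: "0 < M" "real (card ?A) = M" using assms(2) by (simp_all add: M_def card_tuples)
  have N: "0 < N" "N \<le> M"
    using assms(3) finite_edges card_mono[OF fin edges_subset_tuples] M(2)
    by (auto simp: N_def card_gt_0_iff)
  have p: "0 \<le> p" "p \<le> 1" "N * p = \<alpha> * n"
    using assms(1,4) N(1) by (auto simp: p_def edge_prob_eq N_def)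
  have r: "0 \<le> r" "M * r = \<alpha> * n" "r \<le> p"
  proof -
    show "0 \<le> r" using assms(1) by (simp add: r_def)
    show "M * r = \<alpha> * n" using M(1) by (simp add: r_def M_def)
    show "r \<le> p"
      using N assms(1) unfolding p_def r_def edge_prob_eq N_def[symmetric] M_def[symmetric]
      by (intro divide_left_mono) auto
  qed
  have q: "0 \<le> q \<and> q \<le> 1" unfolding q_def using r(1) by (rule one_minus_exp_bounds)
  have qr: "q \<le> r" "r - q \<le> r\<^sup>2"
  proof -
    show "q \<le> r" using exp_ge_add_one_self[of "- r"] by (simp add: q_def)
    \<comment> \<open>\<open>exp (- r) \<le> 1 / (1 + r) \<le> 1 - r + r\<^sup>2\<close>\<close>
    have "exp (- r) * (1 + r) \<le> exp (- r) * exp r"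
      by (intro mult_left_mono exp_ge_add_one_self) auto
    then have "exp (- r) * (1 + r) \<le> 1" by (simp flip: exp_add)
    moreover have "(1 - r + r\<^sup>2) * (1 + r) = 1 + r ^ 3"
      by (simp add: algebra_simps power2_eq_square power3_eq_cube)
    ultimately have "exp (- r) * (1 + r) \<le> (1 - r + r\<^sup>2) * (1 + r)"
      using zero_le_power[OF r(1), of 3] by linarith
    then have "exp (- r) \<le> 1 - r + r\<^sup>2" using r(1) by (simp add: mult_le_cancel_right)
    then show "r - q \<le> r\<^sup>2" by (simp add: q_def)
  qed
  let ?p = "\<lambda>e. if e \<in> ?E then p else 0"
  have "planted_entropy k \<psi> \<alpha> n = bmean ?E ?p (entropy \<psi> n)"
    unfolding planted_entropy_def p_def[symmetric] by (intro bmean_cong) auto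
  also have "\<dots> = bmean ?A ?p (entropy \<psi> n)"
    by (intro bmean_restrict[symmetric] fin edges_subset_tuples) auto
  finally have "\<bar>poisson_entropy k \<psi> \<alpha> n - planted_entropy k \<psi> \<alpha> n\<bar>
      = \<bar>bmean ?A (\<lambda>_. q) (entropy \<psi> n) - bmean ?A ?p (entropy \<psi> n)\<bar>"
    by (simp add: poisson_entropy_def q_def r_def)
  also have "\<dots> \<le> (\<Sum>e\<in>?A. \<bar>q - ?p e\<bar>)"
    using q p by (intro bmean_lipschitz fin entropy_insert_lipschitz) auto
  also have "\<dots> = (\<Sum>e\<in>?E. \<bar>q - p\<bar>) + (\<Sum>e\<in>?A - ?E. q)"
  proof -
    have "(\<Sum>e\<in>?A. \<bar>q - ?p e\<bar>) = (\<Sum>e\<in>?A - ?E. \<bar>q - ?p e\<bar>) + (\<Sum>e\<in>?E. \<bar>q - ?p e\<bar>)"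
      by (rule sum.subset_diff[OF edges_subset_tuples fin])
    then show ?thesis using q by simp
  qed
  also have "\<dots> = N * (p - q) + (M - N) * q"
    using p qr r card_Diff_subset[OF finite_edges edges_subset_tuples] N(2) M(2)
    by (simp add: N_def of_nat_diff card_mono[OF fin edges_subset_tuples])
  also have "\<dots> = N * p - N * r + N * (r - q) + (M - N) * q"
    by (simp add: algebra_simps)
  also have "\<dots> \<le> N * p - N * r + M * r\<^sup>2 + (M - N) * r"
    using N M qr q r by (intro add_mono order_refl mult_mono) auto
  also have "\<dots> = 2 * (\<alpha> * n) - 2 * (N * r) + \<alpha> * n * r"
    using p(3) r(2) by (simp add: algebra_simps power2_eq_square)
  also have "\<dots> = real n * (\<alpha>\<^sup>2 * (real n / real n ^ k) + 2 * \<alpha> * (1 - edge_density k n))"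
    by (simp add: edge_density_def N_def r_def algebra_simps power2_eq_square)
  finally show ?thesis .
qed

lemma planted_entropy_convergent:
  assumes "hypothesis_H k \<psi>" "2 \<le> k" "0 \<le> \<alpha>"
  shows "convergent (\<lambda>n. planted_entropy k \<psi> \<alpha> n / real n)"
proof -
  have "convergent (\<lambda>n. poisson_entropy k \<psi> \<alpha> n / real n)"
    using poisson_entropy_bounds[OF assms(3)] poisson_entropy_subadditive[OF assms(1) _ assms(3)] assms(2)
    by (intro subadditive_limit) auto
  then obtain L where L: "(\<lambda>n. poisson_entropy k \<psi> \<alpha> n / real n) \<longlonglongrightarrow> L"
    by (auto simp: convergent_def)
  have "(\<lambda>n. poisson_entropy k \<psi> \<alpha> n / real n - planted_entropy k \<psi> \<alpha> n / real n) \<longlonglongrightarrow> 0"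
  proof (rule Lim_null_comparison)
    have "(\<lambda>n. \<alpha>\<^sup>2 * (real n / real n ^ k) + 2 * \<alpha> * (1 - edge_density k n)) \<longlonglongrightarrow> \<alpha>\<^sup>2 * 0 + 2 * \<alpha> * (1 - 1)"
      by (intro tendsto_intros sublinear_rate_tendsto assms edge_density_tendsto)
    then show "(\<lambda>n. \<alpha>\<^sup>2 * (real n / real n ^ k) + 2 * \<alpha> * (1 - edge_density k n)) \<longlonglongrightarrow> 0" by simp
    show "\<forall>\<^sub>F n in sequentially. norm (poisson_entropy k \<psi> \<alpha> n / real n - planted_entropy k \<psi> \<alpha> n / real n)
        \<le> \<alpha>\<^sup>2 * (real n / real n ^ k) + 2 * \<alpha> * (1 - edge_density k n)"
      using eventually_gt_at_top[of 0] order_tendstoD(1)[OF edge_density_tendsto[of k], of 0, simplified]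
        order_tendstoD(2)[OF edge_prob_tendsto[OF assms(2), of \<alpha>], of 1, simplified]
    proof eventually_elim
      case (elim n)
      then have "edges k n \<noteq> {}" by (auto simp: edge_density_def)
      with elim assms(3) have "\<bar>poisson_entropy k \<psi> \<alpha> n - planted_entropy k \<psi> \<alpha> n\<bar> / real n
          \<le> \<alpha>\<^sup>2 * (real n / real n ^ k) + 2 * \<alpha> * (1 - edge_density k n)"
        using poisson_planted_entropy_diff[of \<alpha> n k \<psi>] by (simp add: pos_divide_le_eq mult.commute)
      then show ?case by (simp flip: diff_divide_distrib)
    qed
  qed
  from tendsto_diff[OF L this] show ?thesis by (auto simp: convergent_def)
qed

section \<open>Variance bound and concentration\<close>

lemma inj_on_cube_of_set: "inj_on (\<lambda>X. map (\<lambda>i. i \<in> X) [0..<n]) (Pow {..<n})"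
  by (auto simp: inj_on_def)

text \<open>
  A uniform assignment as a random subset of the variables, so that the Efron--Stein inequality applies
  to it.
\<close>

lemma avg_eq_bmean: "avg n f = bmean {..<n} (\<lambda>_. 1 / 2) (\<lambda>X. f (map (\<lambda>i. i \<in> X) [0..<n]))"
proof -
  let ?v = "\<lambda>X. map (\<lambda>i. i \<in> X) [0..<n]"
  have "cube n = ?v ` Pow {..<n}"
  proof
    show "cube n \<subseteq> ?v ` Pow {..<n}"
    proof
      fix v :: "bool list" assume "v \<in> cube n"
      then have "v = ?v {i. i < n \<and> v ! i}" by (auto simp: cube_def intro: nth_equalityI)
      then show "v \<in> ?v ` Pow {..<n}" by blast
    qed
  qed (auto simp: cube_def)
  then have "avg n f = (\<Sum>X\<in>Pow {..<n}. f (?v X)) / 2 ^ n"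
    using inj_on_cube_of_set[of n] by (simp add: avg_def sum.reindex)
  also have "\<dots> = bmean {..<n} (\<lambda>_. 1 / 2) (\<lambda>X. f (?v X))"
  proof -
    have "(1 / 2 :: real) ^ card X * (1 / 2) ^ card ({..<n} - X) = 1 / 2 ^ n" if "X \<subseteq> {..<n}" for X
    proof -
      have "card X + card ({..<n} - X) = n"
        using card_mono[OF _ that] that by (simp add: card_Diff_subset finite_subset)
      then show ?thesis by (simp add: power_one_over flip: power_add)
    qed
    then show ?thesis
      by (simp add: bmean_def sum_divide_distrib)
  qed
  finally show ?thesis .
qed

definition log_solutions :: "(bool list \<Rightarrow> bool) \<Rightarrow> nat \<Rightarrow> nat list set \<Rightarrow> bool list \<Rightarrow> real" where
  "log_solutions \<psi> n S v = ln (real (card (agree \<psi> n S v)))"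

lemma entropy_eq: "entropy \<psi> n S = avg n (log_solutions \<psi> n S)"
  by (simp add: entropy_def log_solutions_def[abs_def])

text \<open>
  For the bit of variable \<open>i\<close>, the comparison function is the log-number of solutions without the clauses that
  contain \<open>i\<close>, which does not depend on this bit of the planted assignment.
\<close>

lemma conditional_variance_le:
  assumes "finite S" "S \<subseteq> tuples k {..<n}"
  shows "avg n (\<lambda>v. (log_solutions \<psi> n S v - entropy \<psi> n S)\<^sup>2)
    \<le> (\<Sum>i<n. 2 * 2 ^ card (S \<inter> {e. i \<in> set e}))"
proof -
  let ?v = "\<lambda>X. map (\<lambda>i. i \<in> X) [0..<n]" and ?X = "log_solutions \<psi> n"
  let ?R = "\<lambda>i. {e \<in> S. i \<notin> set e}"
  have local: "?X (?R i) (?v (insert i X)) = ?X (?R i) (?v (X - {i}))" for i X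
  proof -
    have "restrict_to (?v (insert i X)) e = restrict_to (?v (X - {i})) e" if "e \<in> ?R i" for e
      using that assms(2) by (fastforce simp: restrict_to_def tuples_def)
    then show ?thesis by (simp add: log_solutions_def agree_def)
  qed
  have "avg n (\<lambda>v. (?X S v - entropy \<psi> n S)\<^sup>2)
      \<le> (\<Sum>i<n. bmean {..<n} (\<lambda>_. 1 / 2) (\<lambda>X. (?X S (?v X) - ?X (?R i) (?v X))\<^sup>2))"
    unfolding entropy_eq avg_eq_bmean
    by (rule efron_stein[where g = "\<lambda>i X. ?X (?R i) (?v X)"]) (simp, simp, rule local)
  also have "\<dots> = (\<Sum>i<n. avg n (\<lambda>v. (?X S v - ?X (?R i) v)\<^sup>2))"
    by (simp only: avg_eq_bmean)
  also have "\<dots> \<le> (\<Sum>i<n. 2 * 2 ^ card (S \<inter> {e. i \<in> set e}))"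
  proof (rule sum_mono)
    fix i
    have "S - ?R i = S \<inter> {e. i \<in> set e}" by auto
    then show "avg n (\<lambda>v. (?X S v - ?X (?R i) v)\<^sup>2) \<le> 2 * 2 ^ card (S \<inter> {e. i \<in> set e})"
      using log_ratio_second_moment[of "?R i" S n \<psi>] assms(1) by (simp add: log_solutions_def)
  qed
  finally show ?thesis .
qed

lemma bmean_member:
  assumes "finite A" "a \<in> A"
  shows "bmean A p (\<lambda>S. if a \<in> S then 1 else 0) = p a"
proof -
  have "bmean (insert a (A - {a})) p (\<lambda>S. if a \<in> S then 1 else 0)
      = p a * bmean (A - {a}) p (\<lambda>_. 1) + (1 - p a) * bmean (A - {a}) p (\<lambda>_. 0)"
    using assms(1) by (subst bmean_insert) (auto intro!: arg_cong2[where f = "(+)"] bmean_cong)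
  then show ?thesis using assms by (simp add: insert_absorb bmean_const)
qed

text \<open>
  Removing \<open>e\<close> changes the entropy by at most 1, and only if \<open>e\<close> is present.
\<close>

lemma entropy_variance_le:
  assumes "finite A" "\<And>e. e \<in> A \<Longrightarrow> 0 \<le> p e \<and> p e \<le> 1"
  shows "bmean A p (\<lambda>S. (entropy \<psi> n S - bmean A p (entropy \<psi> n))\<^sup>2) \<le> (\<Sum>e\<in>A. p e)"
proof -
  let ?L = "entropy \<psi> n"
  have "bmean A p (\<lambda>S. (?L S - bmean A p ?L)\<^sup>2) \<le> (\<Sum>e\<in>A. bmean A p (\<lambda>S. (?L S - ?L (S - {e}))\<^sup>2))"
    using assms by (intro efron_stein) auto
  also have "\<dots> \<le> (\<Sum>e\<in>A. bmean A p (\<lambda>S. if e \<in> S then 1 else 0))"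
  proof (intro sum_mono bmean_mono assms(2))
    fix e S
    have "\<bar>?L S - ?L (S - {e})\<bar> \<le> 1" if "e \<in> S"
      using entropy_insert_lipschitz[of \<psi> n e "S - {e}"] that by (simp add: insert_absorb)
    then show "(?L S - ?L (S - {e}))\<^sup>2 \<le> (if e \<in> S then 1 else 0)"
      by (auto simp: abs_square_le_1)
  qed
  also have "\<dots> = (\<Sum>e\<in>A. p e)" using assms(1) by (simp add: bmean_member)
  finally show ?thesis .
qed

lemma card_tuples_containing: "card {e \<in> tuples k {..<n}. i \<in> set e} \<le> k * n ^ (k - 1)"
proof -
  \<comment> \<open>A union bound over the position \<open>j\<close> at which \<open>i\<close> occurs.\<close>
  let ?F = "\<lambda>j. {e. length e = k \<and> (\<forall>l<k. e ! l \<in> (if l = j then {i} else {..<n}))}"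
  have card: "card (?F j) = n ^ (k - 1)" if "j < k" for j
  proof -
    have "card (?F j) = (\<Prod>l<k. card (if l = j then {i} else {..<n}))"
      by (rule card_lists_nth) simp
    also have "\<dots> = (\<Prod>l<k. if l = j then 1 else n)" by (intro prod.cong) auto
    also have "\<dots> = n ^ card ({..<k} \<inter> - {j})"
      by (simp add: prod.If_cases)
    also have "{..<k} \<inter> - {j} = {..<k} - {j}" by auto
    finally show ?thesis using that by simp
  qed
  have fin: "finite (?F j)" for j
  proof (rule finite_subset)
    show "?F j \<subseteq> {e. set e \<subseteq> insert i {..<n} \<and> length e = k}"
      by (auto simp: in_set_conv_nth split: if_splits)
  qed (simp add: finite_lists_length_eq)
  have "{e \<in> tuples k {..<n}. i \<in> set e} \<subseteq> (\<Union>j<k. ?F j)"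
    by (fastforce simp: tuples_def in_set_conv_nth)
  then have "card {e \<in> tuples k {..<n}. i \<in> set e} \<le> card (\<Union>j<k. ?F j)"
    using fin by (intro card_mono) auto
  also have "\<dots> \<le> (\<Sum>j<k. card (?F j))" by (rule card_UN_le) simp
  also have "\<dots> = k * n ^ (k - 1)" using card by simp
  finally show ?thesis .
qed

definition planted_variance :: "nat \<Rightarrow> (bool list \<Rightarrow> bool) \<Rightarrow> real \<Rightarrow> nat \<Rightarrow> real" where
  "planted_variance k \<psi> \<alpha> n = bmean (edges k n) (\<lambda>_. edge_prob k n \<alpha>)
     (\<lambda>S. avg n (\<lambda>v. (log_solutions \<psi> n S v - planted_entropy k \<psi> \<alpha> n)\<^sup>2))"

text \<open>
  The variance splits into the mean conditional variance given the edges and the variance of the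
  entropy.  For the former, the number of clauses on a variable has a bounded exponential moment,
  since its mean is about \<open>\<alpha> * k\<close>.
\<close>

lemma planted_variance_le:
  assumes "0 \<le> \<alpha>" "1 \<le> k" "0 < n" "edges k n \<noteq> {}" "edge_prob k n \<alpha> \<le> 1"
  shows "planted_variance k \<psi> \<alpha> n \<le> real n * (2 * exp (\<alpha> * k / edge_density k n) + \<alpha>)"
proof -
  let ?E = "edges k n" and ?p = "\<lambda>_::nat list. edge_prob k n \<alpha>" and ?X = "log_solutions \<psi> n"
  let ?m = "planted_entropy k \<psi> \<alpha> n" and ?L = "entropy \<psi> n"
  have N: "0 < real (card ?E)" using assms(4) finite_edges by (simp add: card_gt_0_iff)
  have p: "0 \<le> ?p e \<and> ?p e \<le> 1" for e using assms(1,5) by (simp add: edge_prob_def)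
  have split: "avg n (\<lambda>v. (?X S v - ?m)\<^sup>2) = avg n (\<lambda>v. (?X S v - ?L S)\<^sup>2) + (?L S - ?m)\<^sup>2" for S
  proof -
    have "(\<lambda>v. (?X S v - ?m)\<^sup>2)
        = (\<lambda>v. (?X S v - ?L S)\<^sup>2 + (2 * (?L S - ?m) * (?X S v - ?L S) + (?L S - ?m)\<^sup>2))"
      by (simp add: fun_eq_iff power2_eq_square algebra_simps)
    then have "avg n (\<lambda>v. (?X S v - ?m)\<^sup>2)
        = avg n (\<lambda>v. (?X S v - ?L S)\<^sup>2) + (2 * (?L S - ?m) * (avg n (?X S) - ?L S) + (?L S - ?m)\<^sup>2)"
      by (simp only: avg_add avg_diff avg_cmult avg_const)
    then show ?thesis by (simp add: entropy_eq)
  qed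
  have "planted_variance k \<psi> \<alpha> n
      = bmean ?E ?p (\<lambda>S. avg n (\<lambda>v. (?X S v - ?L S)\<^sup>2)) + bmean ?E ?p (\<lambda>S. (?L S - ?m)\<^sup>2)"
    unfolding planted_variance_def split by (rule bmean_add)
  also have "bmean ?E ?p (\<lambda>S. (?L S - ?m)\<^sup>2) \<le> (\<Sum>e\<in>?E. ?p e)"
    unfolding planted_entropy_def by (intro entropy_variance_le finite_edges p)
  also have "(\<Sum>e\<in>?E. ?p e) = \<alpha> * n" using N by (simp add: edge_prob_eq)
  also have "bmean ?E ?p (\<lambda>S. avg n (\<lambda>v. (?X S v - ?L S)\<^sup>2))
      \<le> bmean ?E ?p (\<lambda>S. \<Sum>i<n. 2 * 2 ^ card (S \<inter> {e. i \<in> set e}))"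
  proof (intro bmean_mono p)
    fix S assume "S \<subseteq> ?E"
    then show "avg n (\<lambda>v. (?X S v - ?L S)\<^sup>2) \<le> (\<Sum>i<n. 2 * 2 ^ card (S \<inter> {e. i \<in> set e}))"
      using edges_subset_tuples finite_edges by (intro conditional_variance_le) (auto intro: finite_subset)
  qed
  also have "\<dots> = (\<Sum>i<n. 2 * bmean ?E ?p (\<lambda>S. 2 ^ card (S \<inter> {e. i \<in> set e})))"
    by (simp only: bmean_sum bmean_cmult)
  also have "\<dots> \<le> (\<Sum>i<n. 2 * exp (\<alpha> * k / edge_density k n))"
  proof (intro sum_mono mult_left_mono)
    fix i :: nat
    let ?B = "{e. i \<in> set e}"
    have "card (?E \<inter> ?B) \<le> card {e \<in> tuples k {..<n}. i \<in> set e}"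
      using edges_subset_tuples finite_tuples by (intro card_mono) auto
    then have "real (card (?E \<inter> ?B)) \<le> real (k * n ^ (k - 1))"
      using card_tuples_containing[of k n i] by (simp only: of_nat_le_iff)
    then have "(\<Sum>e\<in>?E \<inter> ?B. ?p e) \<le> real (k * n ^ (k - 1)) * edge_prob k n \<alpha>"
      using p by (simp add: mult_right_mono)
    also have "\<dots> = \<alpha> * k / edge_density k n"
    proof -
      have "real n ^ k = real n * real n ^ (k - 1)"
        using assms(2) by (cases k) auto
      then show ?thesis by (simp add: edge_prob_eq edge_density_def)
    qed
    finally have "exp (\<Sum>e\<in>?E \<inter> ?B. ?p e) \<le> exp (\<alpha> * k / edge_density k n)" by simp
    then show "bmean ?E ?p (\<lambda>S. 2 ^ card (S \<inter> ?B)) \<le> exp (\<alpha> * k / edge_density k n)"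
      using bmean_power_card_le[OF finite_edges, of k n ?p ?B] p by linarith
  qed simp
  also have "(\<Sum>i<n. 2 * exp (\<alpha> * k / edge_density k n)) + \<alpha> * n
      = real n * (2 * exp (\<alpha> * k / edge_density k n) + \<alpha>)"
    by (simp add: algebra_simps)
  finally show ?thesis by simp
qed

lemma planted_variance_sublinear:
  assumes "2 \<le> k" "0 \<le> \<alpha>"
  shows "(\<lambda>n. planted_variance k \<psi> \<alpha> n / (real n)\<^sup>2) \<longlonglongrightarrow> 0"
proof (rule Lim_null_comparison)
  let ?c = "\<lambda>n. 2 * exp (\<alpha> * k / edge_density k n) + \<alpha>"
  have "(\<lambda>n. ?c n * (1 / real n)) \<longlonglongrightarrow> (2 * exp (\<alpha> * k / 1) + \<alpha>) * 0"
    by (intro tendsto_intros edge_density_tendsto lim_1_over_n) auto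
  then show "(\<lambda>n. ?c n * (1 / real n)) \<longlonglongrightarrow> 0" by simp
  show "\<forall>\<^sub>F n in sequentially. norm (planted_variance k \<psi> \<alpha> n / (real n)\<^sup>2) \<le> ?c n * (1 / real n)"
    using eventually_gt_at_top[of 0] order_tendstoD(1)[OF edge_density_tendsto[of k], of 0, simplified]
      order_tendstoD(2)[OF edge_prob_tendsto[OF assms(1), of \<alpha>], of 1, simplified]
  proof eventually_elim
    case (elim n)
    then have "edges k n \<noteq> {}" by (auto simp: edge_density_def)
    with elim assms have "planted_variance k \<psi> \<alpha> n \<le> real n * ?c n"
      by (intro planted_variance_le) auto
    then have "planted_variance k \<psi> \<alpha> n / (real n)\<^sup>2 \<le> real n * ?c n / (real n)\<^sup>2"
      by (rule divide_right_mono) simp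
    also have "\<dots> = ?c n * (1 / real n)" using elim(1) by (simp add: power2_eq_square)
    finally have "planted_variance k \<psi> \<alpha> n / (real n)\<^sup>2 \<le> ?c n * (1 / real n)" .
    moreover have "0 \<le> planted_variance k \<psi> \<alpha> n"
    proof -
      have "bmean (edges k n) (\<lambda>_. edge_prob k n \<alpha>) (\<lambda>_. 0) \<le> planted_variance k \<psi> \<alpha> n"
        unfolding planted_variance_def
      proof (rule bmean_mono)
        show "0 \<le> edge_prob k n \<alpha> \<and> edge_prob k n \<alpha> \<le> 1"
          using elim assms(2) by (simp add: edge_prob_def)
        show "0 \<le> avg n (\<lambda>v. (log_solutions \<psi> n S v - planted_entropy k \<psi> \<alpha> n)\<^sup>2)" for S
          by (simp add: avg_def sum_nonneg)
      qed
      then show ?thesis by (simp add: bmean_const finite_edges)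
    qed
    ultimately show ?case by simp
  qed
qed

lemma set_Pi_pmf_False_subset:
  assumes "finite A"
  shows "set_pmf (Pi_pmf A False p) \<subseteq> (\<lambda>S e. e \<in> S) ` Pow A"
proof
  fix G assume "G \<in> set_pmf (Pi_pmf A False p)"
  then have "\<forall>e. e \<notin> A \<longrightarrow> \<not> G e" using set_Pi_pmf_subset[OF assms, of False p] by auto
  then have "G = (\<lambda>e. e \<in> {e. G e})" "{e. G e} \<in> Pow A" by auto
  then show "G \<in> (\<lambda>S e. e \<in> S) ` Pow A" by (rule image_eqI)
qed

lemma expectation_Pi_bernoulli:
  assumes "finite A" "0 \<le> p" "p \<le> 1"
  shows "measure_pmf.expectation (Pi_pmf A False (\<lambda>_. bernoulli_pmf p)) (\<lambda>G. f {e \<in> A. G e})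
    = bmean A (\<lambda>_. p) f"
proof -
  let ?M = "Pi_pmf A False (\<lambda>_. bernoulli_pmf p)" and ?G = "\<lambda>S e. e \<in> S"
  have inj: "inj_on ?G (Pow A)" by (auto simp: inj_on_def fun_eq_iff)
  have "measure_pmf.expectation ?M (\<lambda>G. f {e \<in> A. G e})
      = (\<Sum>G\<in>?G ` Pow A. pmf ?M G *\<^sub>R f {e \<in> A. G e})"
  proof (rule integral_measure_pmf)
    fix G assume "G \<in> set_pmf ?M"
    then show "G \<in> ?G ` Pow A" using set_Pi_pmf_False_subset[OF assms(1)] by blast
  qed (simp add: assms(1))
  also have "\<dots> = (\<Sum>S\<in>Pow A. pmf ?M (?G S) * f {e \<in> A. e \<in> S})"
    by (simp add: sum.reindex[OF inj])
  also have "\<dots> = bmean A (\<lambda>_. p) f"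
    unfolding bmean_def
  proof (intro sum.cong refl arg_cong2[where f = "(*)"] arg_cong[where f = f])
    fix S assume S: "S \<in> Pow A"
    have "pmf ?M (?G S) = (\<Prod>e\<in>A. pmf (bernoulli_pmf p) (e \<in> S))"
      using S assms(1) by (subst pmf_Pi) auto
    also have "\<dots> = (\<Prod>e\<in>A - S. pmf (bernoulli_pmf p) (e \<in> S)) * (\<Prod>e\<in>S. pmf (bernoulli_pmf p) (e \<in> S))"
      using S assms(1) by (intro prod.subset_diff) auto
    also have "\<dots> = (\<Prod>e\<in>S. p) * (\<Prod>e\<in>A - S. 1 - p)"
      using assms(2,3) by simp
    finally show "pmf ?M (?G S) = (\<Prod>e\<in>S. p) * (\<Prod>e\<in>A - S. 1 - p)" .
    show "{e \<in> A. e \<in> S} = S" using S by auto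
  qed
  finally show ?thesis .
qed

lemma bmean_avg_swap: "bmean A p (\<lambda>S. avg n (F S)) = avg n (\<lambda>v. bmean A p (\<lambda>S. F S v))"
proof -
  have "avg n f = 1 / 2 ^ n * (\<Sum>v\<in>cube n. f v)" for f by (simp add: avg_def)
  then show ?thesis by (simp only: bmean_cmult bmean_sum)
qed

lemma Q_eq_bmean:
  assumes "0 \<le> \<alpha>" "edge_prob k n \<alpha> \<le> 1"
  shows "Q k \<psi> n \<alpha> \<phi> = bmean (edges k n) (\<lambda>_. edge_prob k n \<alpha>)
    (\<lambda>S. avg n (\<lambda>v. if real (card (agree \<psi> n S v)) < 2 powr (real n * \<phi>) then 1 else 0))"
proof -
  let ?E = "edges k n" and ?p = "edge_prob k n \<alpha>"
  let ?M = "Pi_pmf ?E False (\<lambda>_. bernoulli_pmf ?p)"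
  let ?P = "{F. real (num_solutions \<psi> n F) < 2 powr (real n * \<phi>)}"
  let ?F = "\<lambda>v S. (\<lambda>e. (e, \<psi> (restrict_to v e))) ` S"
  let ?I = "\<lambda>S v. if real (card (agree \<psi> n S v)) < 2 powr (real n * \<phi>) then 1 else (0::real)"
  have p: "0 \<le> ?p" using assms(1) by (simp add: edge_prob_def)
  have fin: "finite (set_pmf ?M)"
    using set_Pi_pmf_False_subset[OF finite_edges] by (rule finite_subset) (simp add: finite_edges)
  have num: "num_solutions \<psi> n (?F v S) = card (agree \<psi> n S v)" for v S
    unfolding num_solutions_def agree_def by (rule arg_cong[where f = card]) auto
  have "Q k \<psi> n \<alpha> \<phi> = measure_pmf.expectation (planted_formula k \<psi> n \<alpha>) (indicator ?P)"
    by (simp add: Q_def)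
  also have "\<dots> = (\<Sum>v\<in>cube n. measure_pmf.expectation
      (map_pmf (\<lambda>G. ?F v {e \<in> ?E. G e}) ?M) (indicator ?P) /\<^sub>R card (cube n))"
    unfolding planted_formula_def
    by (rule pmf_expectation_bind_pmf_of_set)
       (use fin card_cube[of n] in \<open>auto simp: finite_cube\<close>)
  also have "\<dots> = avg n (\<lambda>v. measure_pmf.expectation (map_pmf (\<lambda>G. ?F v {e \<in> ?E. G e}) ?M) (indicator ?P))"
    by (simp add: avg_def card_cube divide_inverse mult.commute flip: sum_distrib_left)
  also have "\<dots> = avg n (\<lambda>v. bmean ?E (\<lambda>_. ?p) (\<lambda>S. ?I S v))"
  proof (rule avg_cong)
    fix v
    have "measure_pmf.expectation (map_pmf (\<lambda>G. ?F v {e \<in> ?E. G e}) ?M) (indicator ?P)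
        = measure_pmf.expectation ?M (\<lambda>G. indicator ?P (?F v {e \<in> ?E. G e}) :: real)"
      by (rule integral_map_pmf)
    also have "\<dots> = bmean ?E (\<lambda>_. ?p) (\<lambda>S. indicator ?P (?F v S))"
      by (rule expectation_Pi_bernoulli[OF finite_edges p assms(2)])
    also have "\<dots> = bmean ?E (\<lambda>_. ?p) (\<lambda>S. ?I S v)"
      by (intro bmean_cong refl) (simp add: num indicator_def)
    finally show "measure_pmf.expectation (map_pmf (\<lambda>G. ?F v {e \<in> ?E. G e}) ?M) (indicator ?P)
        = bmean ?E (\<lambda>_. ?p) (\<lambda>S. ?I S v)" .
  qed
  also have "\<dots> = bmean ?E (\<lambda>_. ?p) (\<lambda>S. avg n (?I S))"
    by (rule bmean_avg_swap[symmetric])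
  finally show ?thesis .
qed

lemma Q_chebyshev:
  assumes "0 \<le> \<alpha>" "edge_prob k n \<alpha> \<le> 1" "0 < d"
  shows "real n * \<phi> * ln 2 \<le> planted_entropy k \<psi> \<alpha> n - d
      \<Longrightarrow> Q k \<psi> n \<alpha> \<phi> \<le> planted_variance k \<psi> \<alpha> n / d\<^sup>2"
    and "planted_entropy k \<psi> \<alpha> n + d \<le> real n * \<phi> * ln 2
      \<Longrightarrow> 1 - Q k \<psi> n \<alpha> \<phi> \<le> planted_variance k \<psi> \<alpha> n / d\<^sup>2"
proof -
  let ?E = "edges k n" and ?p = "\<lambda>_::nat list. edge_prob k n \<alpha>"
  let ?m = "planted_entropy k \<psi> \<alpha> n" and ?X = "log_solutions \<psi> n"
  let ?I = "\<lambda>S v. if real (card (agree \<psi> n S v)) < 2 powr (real n * \<phi>) then 1 else (0::real)"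
  have p: "0 \<le> ?p e \<and> ?p e \<le> 1" for e using assms(1,2) by (simp add: edge_prob_def)
  have iff: "real (card (agree \<psi> n S v)) < 2 powr (real n * \<phi>) \<longleftrightarrow> ?X S v < real n * \<phi> * ln 2"
    if "v \<in> cube n" for S v
  proof -
    have "0 < real (card (agree \<psi> n S v))" using card_agree_pos[OF that] by simp
    then have "real (card (agree \<psi> n S v)) < 2 powr (real n * \<phi>)
        \<longleftrightarrow> ln (real (card (agree \<psi> n S v))) < ln (2 powr (real n * \<phi>))"
      by (subst ln_less_cancel_iff) auto
    then show ?thesis by (simp add: log_solutions_def ln_powr)
  qed
  \<comment> \<open>Markov's inequality for the squared deviation, stated so that it covers both the indicator of the
    event in \<^const>\<open>Q\<close> and that of its complement.\<close>
  have markov: "bmean ?E ?p (\<lambda>S. avg n (J S)) \<le> planted_variance k \<psi> \<alpha> n / d\<^sup>2"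
    if J: "\<And>S v. v \<in> cube n \<Longrightarrow> J S v \<le> 1 \<and> (J S v \<le> 0 \<or> d \<le> \<bar>?X S v - ?m\<bar>)" for J
  proof -
    have "bmean ?E ?p (\<lambda>S. avg n (J S)) \<le> bmean ?E ?p (\<lambda>S. avg n (\<lambda>v. 1 / d\<^sup>2 * (?X S v - ?m)\<^sup>2))"
    proof (intro bmean_mono p avg_mono)
      fix S v assume v: "v \<in> cube n"
      show "J S v \<le> 1 / d\<^sup>2 * (?X S v - ?m)\<^sup>2"
      proof (cases "J S v \<le> 0")
        case True
        moreover have "0 \<le> 1 / d\<^sup>2 * (?X S v - ?m)\<^sup>2" by simp
        ultimately show ?thesis by linarith
      next
        case False
        then have "d \<le> \<bar>?X S v - ?m\<bar>" "J S v \<le> 1" using J[OF v] by auto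
        then have "d\<^sup>2 \<le> (?X S v - ?m)\<^sup>2"
          using power_mono[of d "\<bar>?X S v - ?m\<bar>" 2] assms(3) by simp
        then have "1 \<le> 1 / d\<^sup>2 * (?X S v - ?m)\<^sup>2" using assms(3) by (simp add: le_divide_eq)
        then show ?thesis using \<open>J S v \<le> 1\<close> by linarith
      qed
    qed
    also have "\<dots> = planted_variance k \<psi> \<alpha> n / d\<^sup>2"
      by (simp only: planted_variance_def bmean_cmult avg_cmult) simp
    finally show ?thesis .
  qed
  show "Q k \<psi> n \<alpha> \<phi> \<le> planted_variance k \<psi> \<alpha> n / d\<^sup>2"
    if "real n * \<phi> * ln 2 \<le> ?m - d"
    unfolding Q_eq_bmean[OF assms(1,2)] using that by (intro markov) (auto simp: iff)
  have "1 - Q k \<psi> n \<alpha> \<phi> = bmean ?E ?p (\<lambda>S. avg n (\<lambda>v. 1 - ?I S v))"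
    unfolding Q_eq_bmean[OF assms(1,2)] avg_diff bmean_diff avg_const bmean_const[OF finite_edges] ..
  then show "1 - Q k \<psi> n \<alpha> \<phi> \<le> planted_variance k \<psi> \<alpha> n / d\<^sup>2"
    if "?m + d \<le> real n * \<phi> * ln 2"
    using that by (simp only:) (intro markov, auto simp: iff)
qed

lemma planted_entropy_bounds:
  assumes "0 \<le> \<alpha>" "edge_prob k n \<alpha> \<le> 1"
  shows "0 \<le> planted_entropy k \<psi> \<alpha> n" "planted_entropy k \<psi> \<alpha> n \<le> real n * ln 2"
proof -
  let ?E = "edges k n" and ?p = "\<lambda>_::nat list. edge_prob k n \<alpha>"
  have p: "0 \<le> ?p e \<and> ?p e \<le> 1" for e using assms by (simp add: edge_prob_def)
  have "bmean ?E ?p (\<lambda>_. 0) \<le> planted_entropy k \<psi> \<alpha> n"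
    "planted_entropy k \<psi> \<alpha> n \<le> bmean ?E ?p (\<lambda>_. real n * ln 2)"
    unfolding planted_entropy_def by (intro bmean_mono p entropy_nonneg entropy_le)+
  then show "0 \<le> planted_entropy k \<psi> \<alpha> n" "planted_entropy k \<psi> \<alpha> n \<le> real n * ln 2"
    by (simp_all add: bmean_const finite_edges)
qed

text \<open>
  The deviation \<open>\<epsilon>\<close> in bits per variable is \<open>\<epsilon> * ln 2\<close> nats; half of it absorbs the distance between the
  mean and its limit, the other half is left for Chebyshev's inequality.
\<close>

lemma Q_concentration:
  assumes k: "2 \<le> k" and \<alpha>: "0 \<le> \<alpha>" and \<epsilon>: "0 < \<epsilon>"
    and L: "(\<lambda>n. planted_entropy k \<psi> \<alpha> n / real n) \<longlonglongrightarrow> L"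
  shows "(\<lambda>n. Q k \<psi> n \<alpha> (L / ln 2 - \<epsilon>)) \<longlonglongrightarrow> 0"
    and "(\<lambda>n. Q k \<psi> n \<alpha> (L / ln 2 + \<epsilon>)) \<longlonglongrightarrow> 1"
proof -
  define \<delta> where "\<delta> = \<epsilon> * ln 2 / 2"
  have \<delta>: "0 < \<delta>" using \<epsilon> by (simp add: \<delta>_def)
  let ?m = "planted_entropy k \<psi> \<alpha>" and ?V = "planted_variance k \<psi> \<alpha>"
  have close: "\<forall>\<^sub>F n in sequentially. 0 < n \<and> edge_prob k n \<alpha> \<le> 1 \<and> \<bar>?m n - real n * L\<bar> \<le> real n * \<delta>"
    using eventually_gt_at_top[of 0] tendstoD[OF L \<delta>]
      order_tendstoD(2)[OF edge_prob_tendsto[OF k, of \<alpha>], of 1, simplified]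
  proof eventually_elim
    case (elim n)
    then have "?m n - real n * L = real n * (?m n / real n - L)" by (simp add: right_diff_distrib)
    then have "\<bar>?m n - real n * L\<bar> = real n * \<bar>?m n / real n - L\<bar>" by (simp add: abs_mult)
    also have "\<dots> \<le> real n * \<delta>" using elim by (intro mult_left_mono) (auto simp: dist_real_def)
    finally show ?case using elim by simp
  qed
  have V: "(\<lambda>n. ?V n / (real n * \<delta>)\<^sup>2) \<longlonglongrightarrow> 0"
    using tendsto_divide[OF planted_variance_sublinear[OF k \<alpha>, of \<psi>] tendsto_const[of "\<delta>\<^sup>2"]] \<delta>
    by (simp add: power_mult_distrib)
  have le: "\<forall>\<^sub>F n in sequentially. Q k \<psi> n \<alpha> (L / ln 2 - \<epsilon>) \<le> ?V n / (real n * \<delta>)\<^sup>2"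
    using close
  proof eventually_elim
    case (elim n)
    have "real n * (L / ln 2 - \<epsilon>) * ln 2 = real n * L - 2 * (real n * \<delta>)"
      by (simp add: \<delta>_def algebra_simps)
    then have "real n * (L / ln 2 - \<epsilon>) * ln 2 \<le> ?m n - real n * \<delta>" using elim by linarith
    then show ?case using elim \<delta> by (intro Q_chebyshev(1) \<alpha>) auto
  qed
  have ge: "\<forall>\<^sub>F n in sequentially. 1 - Q k \<psi> n \<alpha> (L / ln 2 + \<epsilon>) \<le> ?V n / (real n * \<delta>)\<^sup>2"
    using close
  proof eventually_elim
    case (elim n)
    have "real n * (L / ln 2 + \<epsilon>) * ln 2 = real n * L + 2 * (real n * \<delta>)"
      by (simp add: \<delta>_def algebra_simps)
    then have "?m n + real n * \<delta> \<le> real n * (L / ln 2 + \<epsilon>) * ln 2" using elim by linarith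
    then show ?case using elim \<delta> by (intro Q_chebyshev(2) \<alpha>) auto
  qed
  show "(\<lambda>n. Q k \<psi> n \<alpha> (L / ln 2 - \<epsilon>)) \<longlonglongrightarrow> 0"
    by (rule tendsto_sandwich[OF _ le tendsto_const V]) (simp add: Q_def)
  have "(\<lambda>n. 1 - Q k \<psi> n \<alpha> (L / ln 2 + \<epsilon>)) \<longlonglongrightarrow> 0"
    by (rule tendsto_sandwich[OF _ ge tendsto_const V]) (simp add: Q_def)
  from tendsto_diff[OF tendsto_const[of 1] this]
  show "(\<lambda>n. Q k \<psi> n \<alpha> (L / ln 2 + \<epsilon>)) \<longlonglongrightarrow> 1" by simp
qed

theorem theorem6:
  fixes k :: nat and \<psi> :: "bool list \<Rightarrow> bool"
  assumes "k \<ge> 2"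
    and "antisymmetric k \<psi>"
    and "hypothesis_H k \<psi>"
  shows "\<exists>(D :: real set) (\<phi>\<^sub>s :: real \<Rightarrow> real).
    countable D \<and> \<phi>\<^sub>s \<in> {0..} \<rightarrow> {0..1} \<and>
    (\<forall>\<alpha> \<in> {0..} - D. \<forall>\<epsilon>>0.
       (\<lambda>n. Q k \<psi> n \<alpha> (\<phi>\<^sub>s \<alpha> - \<epsilon>)) \<longlonglongrightarrow> 0 \<and>
       (\<lambda>n. Q k \<psi> n \<alpha> (\<phi>\<^sub>s \<alpha> + \<epsilon>)) \<longlonglongrightarrow> 1)"
proof -
  let ?h = "\<lambda>\<alpha> n. planted_entropy k \<psi> \<alpha> n / real n"
  define L where "L = (\<lambda>\<alpha>. lim (?h \<alpha>))"
  have L: "?h \<alpha> \<longlonglongrightarrow> L \<alpha>" if "0 \<le> \<alpha>" for \<alpha>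
    using planted_entropy_convergent[OF assms(3,1) that] by (simp add: L_def convergent_LIMSEQ_iff)
  have range: "0 \<le> L \<alpha> \<and> L \<alpha> \<le> ln 2" if "0 \<le> \<alpha>" for \<alpha>
  proof -
    have "\<forall>\<^sub>F n in sequentially. 0 \<le> ?h \<alpha> n \<and> ?h \<alpha> n \<le> ln 2"
      using eventually_gt_at_top[of 0] order_tendstoD(2)[OF edge_prob_tendsto[OF assms(1), of \<alpha>], of 1, simplified]
    proof eventually_elim
      case (elim n)
      then show ?case
        using planted_entropy_bounds[OF that, of k n \<psi>] by (simp add: divide_le_eq mult.commute)
    qed
    then show ?thesis
      using tendsto_lowerbound[OF L[OF that], of 0] tendsto_upperbound[OF L[OF that], of "ln 2"]
      by (auto simp: eventually_conj_iff)
  qed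
  show ?thesis
  proof (intro exI conjI)
    show "countable ({} :: real set)" by simp
    show "(\<lambda>\<alpha>. L \<alpha> / ln 2) \<in> {0..} \<rightarrow> {0..1}"
      using range by (auto simp: divide_le_eq)
    show "\<forall>\<alpha>\<in>{0..} - {}. \<forall>\<epsilon>>0.
       (\<lambda>n. Q k \<psi> n \<alpha> (L \<alpha> / ln 2 - \<epsilon>)) \<longlonglongrightarrow> 0 \<and>
       (\<lambda>n. Q k \<psi> n \<alpha> (L \<alpha> / ln 2 + \<epsilon>)) \<longlonglongrightarrow> 1"
      using Q_concentration[OF assms(1) _ _ L] by auto
  qed
qed

end
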